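(* Let $T>0$ and let $(V,d,\pi,\kappa)$ and $(\phi,\psi^*,\alpha)$ satisfy the standing assumptions listed in the context. Assume that $\mathrm{Lip}_b(V)$ is dense in $\mathcal X_2$ in the following sense: for every $\varphi\in\mathcal X_2$ there exists a sequence $(\varphi_n)_n\subset\mathrm{Lip}_b(V)$ such that, as $n\to\infty$, $\varphi_n\to\varphi$ in $L^1(V;\pi)$ and $\overline\nabla\varphi_n\to\overline\nabla\varphi$ in $L^2(E;\vartheta_\kappa)$. Let $(\rho,j)\in\mathcal{ACE}([0,T])$ with $u=\frac{\mathrm d\rho}{\mathrm d\pi}\in L^\infty(0,T;L^\infty(V;\pi))$. Then $(\rho,j)\in\mathcal{RCE}([0,T])$.
   Context: **Setting.** $(V,d)$ is a separable metric space, $\pi$ a finite positive Borel measure on $V$, $E:=V\times V$, $E':=E\setminus\{(x,x):x\in V\}$, $\mathcal M^+(V)$ is the set of finite positive Borel measures on $V$. The jump kernel $\kappa=(\kappa(x,\cdot))_{x\in V}$ is a family of positive $\sigma$-finite Borel measures on $V$ with $\kappa(x,\{x\})=0$, such that $x\mapsto\int_V f(y)(1\wedge d^2(x,y))\,\kappa(x,\mathrm dy)$ is Borel for every bounded Borel $f:V\to\mathbb R$, and $\sup_{x\in V}\int_V(1\wedge d^2(x,y))\,\kappa(x,\mathrm dy)<\infty$. The $\sigma$-finite measure $\vartheta_\kappa(\mathrm dx\,\mathrm dy):=\pi(\mathrm dx)\,\kappa(x,\mathrm dy)$ on $E$ is invariant under $(x,y)\mapsto(y,x)$ (detailed balance).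 Write $\overline\nabla\varphi(x,y):=\varphi(y)-\varphi(x)$. $\mathrm{Lip}_b(V)$ is the space of bounded $d$-Lipschitz functions and $\mathcal X_2:=\{\varphi\in L^\infty(V;\pi):\iint_{E'}|\overline\nabla\varphi|^2\,\mathrm d\vartheta_\kappa<\infty\}$. **Fluxes.** For a separable metric space $Y$, $\mathcal M_\sigma(Y)$ is the set of pairs $\mu=(\mu^+,\mu^-)$ of mutually singular $\sigma$-finite positive Borel measures on $Y$; $|\mu|:=\mu^++\mu^-$ and $\int f\,\mathrm d\mu:=\int f\,\mathrm d\mu^+-\int f\,\mathrm d\mu^-$ for $f\in L^1(|\mu|)$. A family $(j_t)_{t\in[0,T]}\subset\mathcal M_\sigma(E)$ is measurable if $t\mapsto j_t^\pm(B)$ is Borel for every Borel $B$. If $|\mu|\ll\gamma$ with $\gamma$ positive $\sigma$-finite, $\frac{\mathrm d\mu}{\mathrm d\gamma}:=\frac{\mathrm d\mu^+}{\mathrm d\gamma}-\frac{\mathrm d\mu^-}{\mathrm d\gamma}$. **Densities.** $\phi\in C([0,\infty))\cap C^1((0,\infty))$ is convex, $\min\phi=0$, $\lim_{r\to\infty}\phi(r)/r=\infty$. $\psi^*:\mathbb R\to[0,\infty)$ is convex, differentiable, even, $\psi^*(0)=0$, $\lim_{|\xi|\to\infty}\psi^*(\xi)/|\xi|=\infty$, $\lim_{\xi\to0}\psi^*(\xi)/|\xi|^2\in(0,\infty)$; $\psi$ is its convex conjugate. $\alpha:[0,\infty)^2\to[0,\infty)$ is not identically zero, continuous, concave, symmetric.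 **Functionals.** $\mathscr E(\rho):=\int_V\phi(\frac{\mathrm d\rho}{\mathrm d\pi})\,\mathrm d\pi$ if $\rho\ll\pi$, $+\infty$ otherwise. For $\rho=u\pi$ and $j\in\mathcal M_\sigma(E)$ let $\nu_\rho(\mathrm dx\,\mathrm dy):=\alpha(u(x),u(y))\,\vartheta_\kappa(\mathrm dx\,\mathrm dy)$ and $\mathscr R(\rho,j):=\frac12\iint\psi\big(\frac{\mathrm d(2j)}{\mathrm d\nu_\rho}\big)\,\mathrm d\nu_\rho$ if $|j|\ll\nu_\rho$, $+\infty$ otherwise. Set $\phi'(0):=\lim_{r\downarrow0}\phi'(r)\in[-\infty,\infty)$, $\Lambda_\phi(u,v):=\phi'(v)-\phi'(u)$ for $(u,v)\ne(0,0)$, $\Lambda_\phi(0,0):=0$. $D_\phi^+(u,v):=\psi^*(\Lambda_\phi(u,v))\alpha(u,v)$ if $\alpha(u,v)>0$ (with $\psi^*(\pm\infty)=+\infty$), $:=0$ if $u=v=0$, $:=+\infty$ if $\alpha(u,v)=0$ and $u\neq v$; $D_\phi:[0,\infty)^2\to[0,\infty]$ is the lower semicontinuous envelope of $D_\phi^+$. The Fisher information is $\mathscr D(\rho):=\frac12\iint_E D_\phi(u(x),u(y))\,\vartheta_\kappa(\mathrm dx\,\mathrm dy)$ for $\rho=u\pi$. Standing assumption: $\mathscr D$ is lower semicontinuous under setwise convergence, i.e. if $\rho_n,\rho$ have finite entropy and $\rho_n(B)\to\rho(B)$ for all Borel $B$, then $\liminf_n\mathscr D(\rho_n)\ge\mathscr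 D(\rho)$. **Continuity equations.** $(\rho,j)\in\mathcal{CE}([0,T])$ means: $\rho=(\rho_t)_{t\in[0,T]}\subset\mathcal M^+(V)$; $j=(j_t)_{t\in[0,T]}\subset\mathcal M_\sigma(E)$ is a measurable family with $|j_t|(E\setminus E')=0$ and $\int_0^T\iint_E(1\wedge d(x,y))\,|j_t|(\mathrm dx\,\mathrm dy)\,\mathrm dt<\infty$; and for all $\varphi\in\mathrm{Lip}_b(V)$ and $[s,t]\subset[0,T]$: ( * ) $\int_V\varphi\,\mathrm d\rho_t-\int_V\varphi\,\mathrm d\rho_s=\int_s^t\iint_{E'}\overline\nabla\varphi(x,y)\,j_r(\mathrm dx\,\mathrm dy)\,\mathrm dr$. $\mathcal{ACE}([0,T])$: pairs in $\mathcal{CE}([0,T])$ with $\sup_{t\in[0,T]}\mathscr E(\rho_t)<\infty$ and $\int_0^T(\mathscr R(\rho_t,j_t)+\mathscr D(\rho_t))\,\mathrm dt<\infty$. $\mathcal{RCE}([0,T])$: pairs $(\rho,j)\in\mathcal{ACE}([0,T])$, $\rho_t=u_t\pi$, with $\operatorname{ess\,sup}_{t\in(0,T)}\|u_t\|_{L^\infty(V;\pi)}<\infty$ (that is, $u\in L^\infty(0,T;L^\infty(V;\pi))$), such that ( * ) holds for all $[s,t]\subset[0,T]$ and all $\varphi\in\mathcal X_2$. *)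

theory Defs
  imports "HOL-Analysis.Analysis"
begin

text \<open>
  The separable metric space \<open>V\<close> is a type of class \<open>metric_space\<close> and
  \<open>second_countable_topology\<close>; for metric spaces second countability is separability.
  In particular the Borel sets of \<open>V \<times> V\<close> are those of the product sigma-algebra.
\<close>

definition finite_borel_measures :: "'a::topological_space measure set" where
  "finite_borel_measures = {\<mu>. sets \<mu> = sets borel \<and> finite_measure \<mu>}"

definition sigma_finite_borel_measures :: "'a::topological_space measure set" where
  "sigma_finite_borel_measures = {\<mu>. sets \<mu> = sets borel \<and> sigma_finite_measure \<mu>}"

definition off_diagonal :: "('a \<times> 'a) set" where
  "off_diagonal = {(x, y). x \<noteq> y}"

definition nonlocal_grad :: "('a \<Rightarrow> real) \<Rightarrow> 'a \<times> 'a \<Rightarrow> real" where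
  "nonlocal_grad f = (\<lambda>(x, y). f y - f x)"

text \<open>A flux is the pair of its positive and its negative part.\<close>

type_synonym 'b flux = "'b measure \<times> 'b measure"

definition mutually_singular :: "'b measure \<Rightarrow> 'b measure \<Rightarrow> bool" where
  "mutually_singular \<mu> \<nu> \<longleftrightarrow>
     (\<exists>A \<in> sets \<mu>. A \<in> sets \<nu> \<and> emeasure \<mu> A = 0 \<and> emeasure \<nu> (space \<nu> - A) = 0)"

definition fluxes :: "'b::topological_space flux set" where
  "fluxes = {(\<mu>p, \<mu>m). \<mu>p \<in> sigma_finite_borel_measures \<and> \<mu>m \<in> sigma_finite_borel_measures
                       \<and> mutually_singular \<mu>p \<mu>m}"

definition total_variation :: "'b::topological_space flux \<Rightarrow> 'b measure" where
  "total_variation \<mu> =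
     measure_of UNIV (sets borel) (\<lambda>B. emeasure (fst \<mu>) B + emeasure (snd \<mu>) B)"

definition flux_integral :: "'b set \<Rightarrow> 'b flux \<Rightarrow> ('b \<Rightarrow> real) \<Rightarrow> real" where
  "flux_integral S \<mu> f = (LINT z:S|fst \<mu>. f z) - (LINT z:S|snd \<mu>. f z)"

definition double_flux :: "'b flux \<Rightarrow> 'b flux" where
  "double_flux \<mu> = (scale_measure 2 (fst \<mu>), scale_measure 2 (snd \<mu>))"

text \<open>Densities are real-valued; the library's \<open>RN_deriv\<close> is finite almost everywhere for
  sigma-finite measures.\<close>

definition measure_density :: "'b measure \<Rightarrow> 'b measure \<Rightarrow> 'b \<Rightarrow> real" where
  "measure_density \<gamma> \<mu> z = enn2real (RN_deriv \<gamma> \<mu> z)"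

definition flux_density :: "'b measure \<Rightarrow> 'b flux \<Rightarrow> 'b \<Rightarrow> real" where
  "flux_density \<gamma> \<mu> z = measure_density \<gamma> (fst \<mu>) z - measure_density \<gamma> (snd \<mu>) z"

definition edge_measure :: "'a::topological_space measure \<Rightarrow> ('a \<Rightarrow> 'a measure) \<Rightarrow> ('a \<times> 'a) measure" where
  "edge_measure \<pi> \<kappa> =
     measure_of UNIV (sets borel) (\<lambda>B. \<integral>\<^sup>+x. emeasure (\<kappa> x) {y. (x, y) \<in> B} \<partial>\<pi>)"

definition jump_setting ::
    "'a::{metric_space, second_countable_topology} measure \<Rightarrow> ('a \<Rightarrow> 'a measure) \<Rightarrow> bool" where
  "jump_setting \<pi> \<kappa> \<longleftrightarrow>
     \<pi> \<in> finite_borel_measures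
   \<and> (\<forall>x. \<kappa> x \<in> sigma_finite_borel_measures \<and> emeasure (\<kappa> x) {x} = 0)
   \<and> (\<forall>f \<in> borel_measurable borel. bounded (range f) \<longrightarrow>
        (\<lambda>x. LINT y|\<kappa> x. f y * min 1 ((dist x y)\<^sup>2)) \<in> borel_measurable borel)
   \<and> (SUP x. \<integral>\<^sup>+y. ennreal (min 1 ((dist x y)\<^sup>2)) \<partial>\<kappa> x) < \<infinity>
   \<and> distr (edge_measure \<pi> \<kappa>) borel prod.swap = edge_measure \<pi> \<kappa>"

definition Lip_b :: "('a::metric_space \<Rightarrow> real) set" where
  "Lip_b = {f. bounded (range f) \<and> (\<exists>L. L-lipschitz_on UNIV f)}"

text \<open>Classes modulo \<open>\<pi>\<close>-null sets are represented by their Borel members.\<close>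

definition X2 :: "'a::topological_space measure \<Rightarrow> ('a \<Rightarrow> 'a measure) \<Rightarrow> ('a \<Rightarrow> real) set" where
  "X2 \<pi> \<kappa> = {f \<in> borel_measurable borel.
     (\<exists>C. AE x in \<pi>. \<bar>f x\<bar> \<le> C) \<and>
     (\<integral>\<^sup>+z\<in>off_diagonal. ennreal ((nonlocal_grad f z)\<^sup>2) \<partial>edge_measure \<pi> \<kappa>) < \<infinity>}"

definition Lip_b_dense_in_X2 :: "'a::metric_space measure \<Rightarrow> ('a \<Rightarrow> 'a measure) \<Rightarrow> bool" where
  "Lip_b_dense_in_X2 \<pi> \<kappa> \<longleftrightarrow>
     (\<forall>f \<in> X2 \<pi> \<kappa>. \<exists>F :: nat \<Rightarrow> 'a \<Rightarrow> real. (\<forall>n. F n \<in> Lip_b)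
        \<and> (\<lambda>n. \<integral>\<^sup>+x. ennreal \<bar>F n x - f x\<bar> \<partial>\<pi>) \<longlonglongrightarrow> 0
        \<and> (\<lambda>n. \<integral>\<^sup>+z. ennreal ((nonlocal_grad (F n) z - nonlocal_grad f z)\<^sup>2) \<partial>edge_measure \<pi> \<kappa>)
             \<longlonglongrightarrow> 0)"

definition entropy_density :: "(real \<Rightarrow> real) \<Rightarrow> bool" where
  "entropy_density \<phi> \<longleftrightarrow>
     continuous_on {0..} \<phi> \<and> \<phi> C1_differentiable_on {0<..} \<and> convex_on {0..} \<phi>
   \<and> (\<forall>r\<ge>0. 0 \<le> \<phi> r) \<and> (\<exists>r\<ge>0. \<phi> r = 0)
   \<and> filterlim (\<lambda>r. \<phi> r / r) at_top at_top"

definition dual_dissipation_density :: "(real \<Rightarrow> real) \<Rightarrow> bool" where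
  "dual_dissipation_density \<psi>s \<longleftrightarrow>
     (\<forall>\<xi>. 0 \<le> \<psi>s \<xi>) \<and> convex_on UNIV \<psi>s \<and> \<psi>s differentiable_on UNIV
   \<and> (\<forall>\<xi>. \<psi>s (- \<xi>) = \<psi>s \<xi>) \<and> \<psi>s 0 = 0
   \<and> filterlim (\<lambda>\<xi>. \<psi>s \<xi> / \<bar>\<xi>\<bar>) at_top at_infinity
   \<and> (\<exists>c>0. ((\<lambda>\<xi>. \<psi>s \<xi> / \<bar>\<xi>\<bar>\<^sup>2) \<longlongrightarrow> c) (at 0))"

definition mobility_density :: "(real \<Rightarrow> real \<Rightarrow> real) \<Rightarrow> bool" where
  "mobility_density \<alpha> \<longleftrightarrow>
     (\<forall>u\<ge>0. \<forall>v\<ge>0. 0 \<le> \<alpha> u v) \<and> (\<exists>u\<ge>0. \<exists>v\<ge>0. \<alpha> u v \<noteq> 0)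
   \<and> continuous_on ({0..} \<times> {0..}) (\<lambda>(u, v). \<alpha> u v)
   \<and> concave_on ({0..} \<times> {0..}) (\<lambda>(u, v). \<alpha> u v)
   \<and> (\<forall>u\<ge>0. \<forall>v\<ge>0. \<alpha> u v = \<alpha> v u)"

definition convex_conjugate :: "(real \<Rightarrow> real) \<Rightarrow> real \<Rightarrow> ereal" where
  "convex_conjugate f s = (SUP \<xi>. ereal (s * \<xi> - f \<xi>))"

definition entropy :: "'a measure \<Rightarrow> (real \<Rightarrow> real) \<Rightarrow> 'a measure \<Rightarrow> ennreal" where
  "entropy \<pi> \<phi> \<rho> =
     (if absolutely_continuous \<pi> \<rho>
      then \<integral>\<^sup>+x. ennreal (\<phi> (measure_density \<pi> \<rho> x)) \<partial>\<pi> else \<infinity>)"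

definition weighted_edge_measure ::
    "'a::topological_space measure \<Rightarrow> ('a \<Rightarrow> 'a measure) \<Rightarrow> (real \<Rightarrow> real \<Rightarrow> real) \<Rightarrow> 'a measure
      \<Rightarrow> ('a \<times> 'a) measure" where
  "weighted_edge_measure \<pi> \<kappa> \<alpha> \<rho> =
     density (edge_measure \<pi> \<kappa>)
       (\<lambda>(x, y). ennreal (\<alpha> (measure_density \<pi> \<rho> x) (measure_density \<pi> \<rho> y)))"

text \<open>The dissipation potential and the Fisher information only concern \<open>\<rho> \<lless> \<pi>\<close>; they are
  set to \<open>\<infinity>\<close> elsewhere, which is immaterial for curves of finite entropy.\<close>

definition dissipation_potential ::
    "'a::topological_space measure \<Rightarrow> ('a \<Rightarrow> 'a measure) \<Rightarrow> (real \<Rightarrow> real) \<Rightarrow> (real \<Rightarrow> real \<Rightarrow> real)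
      \<Rightarrow> 'a measure \<Rightarrow> ('a \<times> 'a) flux \<Rightarrow> ennreal" where
  "dissipation_potential \<pi> \<kappa> \<psi>s \<alpha> \<rho> j =
     (let \<nu> = weighted_edge_measure \<pi> \<kappa> \<alpha> \<rho> in
      if absolutely_continuous \<pi> \<rho> \<and> absolutely_continuous \<nu> (total_variation j)
      then (1 / 2) * (\<integral>\<^sup>+z. e2ennreal (convex_conjugate \<psi>s (flux_density \<nu> (double_flux j) z)) \<partial>\<nu>)
      else \<infinity>)"

definition entropy_deriv :: "(real \<Rightarrow> real) \<Rightarrow> real \<Rightarrow> ereal" where
  "entropy_deriv \<phi> r =
     (if r = 0 then Lim (at_right 0) (\<lambda>s. ereal (deriv \<phi> s)) else ereal (deriv \<phi> r))"

definition entropy_deriv_diff :: "(real \<Rightarrow> real) \<Rightarrow> real \<Rightarrow> real \<Rightarrow> ereal" where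
  "entropy_deriv_diff \<phi> u v =
     (if u = 0 \<and> v = 0 then 0 else entropy_deriv \<phi> v - entropy_deriv \<phi> u)"

definition extend_infinity :: "(real \<Rightarrow> real) \<Rightarrow> ereal \<Rightarrow> ennreal" where
  "extend_infinity f \<xi> = (if \<bar>\<xi>\<bar> = \<infinity> then \<infinity> else ennreal (f (real_of_ereal \<xi>)))"

text \<open>The remaining case \<open>u = v > 0\<close>, \<open>\<alpha> u v = 0\<close> does not occur: a concave, nonnegative
  \<open>\<alpha>\<close> that is not identically zero is positive on the open quadrant.\<close>

definition fisher_density_plus ::
    "(real \<Rightarrow> real) \<Rightarrow> (real \<Rightarrow> real) \<Rightarrow> (real \<Rightarrow> real \<Rightarrow> real) \<Rightarrow> real \<times> real \<Rightarrow> ennreal" where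
  "fisher_density_plus \<phi> \<psi>s \<alpha> = (\<lambda>(u, v).
     if \<alpha> u v > 0 then extend_infinity \<psi>s (entropy_deriv_diff \<phi> u v) * ennreal (\<alpha> u v)
     else if u = 0 \<and> v = 0 then 0
     else \<infinity>)"

definition lower_semicontinuous_on :: "'b::topological_space set \<Rightarrow> ('b \<Rightarrow> ennreal) \<Rightarrow> bool" where
  "lower_semicontinuous_on S g \<longleftrightarrow> (\<forall>z\<in>S. g z \<le> Liminf (at z within S) g)"

definition lsc_envelope :: "'b::topological_space set \<Rightarrow> ('b \<Rightarrow> ennreal) \<Rightarrow> 'b \<Rightarrow> ennreal" where
  "lsc_envelope S f z =
     (SUP g \<in> {g. lower_semicontinuous_on S g \<and> (\<forall>w\<in>S. g w \<le> f w)}. g z)"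

definition fisher_density ::
    "(real \<Rightarrow> real) \<Rightarrow> (real \<Rightarrow> real) \<Rightarrow> (real \<Rightarrow> real \<Rightarrow> real) \<Rightarrow> real \<times> real \<Rightarrow> ennreal" where
  "fisher_density \<phi> \<psi>s \<alpha> = lsc_envelope ({0..} \<times> {0..}) (fisher_density_plus \<phi> \<psi>s \<alpha>)"

definition fisher_information ::
    "'a::topological_space measure \<Rightarrow> ('a \<Rightarrow> 'a measure) \<Rightarrow> (real \<Rightarrow> real) \<Rightarrow> (real \<Rightarrow> real)
      \<Rightarrow> (real \<Rightarrow> real \<Rightarrow> real) \<Rightarrow> 'a measure \<Rightarrow> ennreal" where
  "fisher_information \<pi> \<kappa> \<phi> \<psi>s \<alpha> \<rho> =
     (if absolutely_continuous \<pi> \<rho>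
      then (1 / 2) * (\<integral>\<^sup>+(x, y). fisher_density \<phi> \<psi>s \<alpha>
                         (measure_density \<pi> \<rho> x, measure_density \<pi> \<rho> y) \<partial>edge_measure \<pi> \<kappa>)
      else \<infinity>)"

definition fisher_information_lsc ::
    "'a::topological_space measure \<Rightarrow> ('a \<Rightarrow> 'a measure) \<Rightarrow> (real \<Rightarrow> real) \<Rightarrow> (real \<Rightarrow> real)
      \<Rightarrow> (real \<Rightarrow> real \<Rightarrow> real) \<Rightarrow> bool" where
  "fisher_information_lsc \<pi> \<kappa> \<phi> \<psi>s \<alpha> \<longleftrightarrow>
     (\<forall>(R :: nat \<Rightarrow> 'a measure) \<rho>.
        (\<forall>n. R n \<in> finite_borel_measures \<and> entropy \<pi> \<phi> (R n) < \<infinity>) \<longrightarrow>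
        \<rho> \<in> finite_borel_measures \<longrightarrow> entropy \<pi> \<phi> \<rho> < \<infinity> \<longrightarrow>
        (\<forall>B \<in> sets borel. (\<lambda>n. measure (R n) B) \<longlonglongrightarrow> measure \<rho> B) \<longrightarrow>
        fisher_information \<pi> \<kappa> \<phi> \<psi>s \<alpha> \<rho>
          \<le> liminf (\<lambda>n. fisher_information \<pi> \<kappa> \<phi> \<psi>s \<alpha> (R n)))"

definition measurable_flux_family :: "real \<Rightarrow> (real \<Rightarrow> 'b::topological_space flux) \<Rightarrow> bool" where
  "measurable_flux_family T j \<longleftrightarrow>
     (\<forall>t\<in>{0..T}. j t \<in> fluxes) \<and>
     (\<forall>B \<in> sets borel.
        (\<lambda>t. emeasure (fst (j t)) B) \<in> borel_measurable (restrict_space borel {0..T}) \<and>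
        (\<lambda>t. emeasure (snd (j t)) B) \<in> borel_measurable (restrict_space borel {0..T}))"

text \<open>The continuity equation tested against \<open>f\<close>. Bochner integrals of non-integrable functions
  are \<open>0\<close> in the library, so the existence of the integrals is part of the definition; for
  \<open>f \<in> Lip_b\<close> it follows from the moment bound in \<open>CE\<close>.\<close>

definition tested_continuity_equation ::
    "real \<Rightarrow> (real \<Rightarrow> 'a::topological_space measure) \<Rightarrow> (real \<Rightarrow> ('a \<times> 'a) flux) \<Rightarrow> ('a \<Rightarrow> real) \<Rightarrow> bool"
  where
  "tested_continuity_equation T \<rho> j f \<longleftrightarrow>
     (\<forall>t\<in>{0..T}. integrable (\<rho> t) f)
   \<and> (AE r in lborel. r \<in> {0..T} \<longrightarrow>
        set_integrable (total_variation (j r)) off_diagonal (nonlocal_grad f))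
   \<and> set_integrable lborel {0..T} (\<lambda>r. flux_integral off_diagonal (j r) (nonlocal_grad f))
   \<and> (\<forall>s t. 0 \<le> s \<longrightarrow> s \<le> t \<longrightarrow> t \<le> T \<longrightarrow>
        (LINT x|\<rho> t. f x) - (LINT x|\<rho> s. f x)
        = (LINT r:{s..t}|lborel. flux_integral off_diagonal (j r) (nonlocal_grad f)))"

definition CE :: "real \<Rightarrow> ((real \<Rightarrow> 'a::metric_space measure) \<times> (real \<Rightarrow> ('a \<times> 'a) flux)) set" where
  "CE T = {(\<rho>, j).
     (\<forall>t\<in>{0..T}. \<rho> t \<in> finite_borel_measures)
   \<and> measurable_flux_family T j
   \<and> (\<forall>t\<in>{0..T}. emeasure (total_variation (j t)) (UNIV - off_diagonal) = 0)
   \<and> (\<integral>\<^sup>+t\<in>{0..T}. (\<integral>\<^sup>+(x, y). ennreal (min 1 (dist x y)) \<partial>total_variation (j t)) \<partial>lborel) < \<infinity>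
   \<and> (\<forall>f \<in> Lip_b. tested_continuity_equation T \<rho> j f)}"

definition ACE ::
    "'a::metric_space measure \<Rightarrow> ('a \<Rightarrow> 'a measure) \<Rightarrow> (real \<Rightarrow> real) \<Rightarrow> (real \<Rightarrow> real)
      \<Rightarrow> (real \<Rightarrow> real \<Rightarrow> real) \<Rightarrow> real
      \<Rightarrow> ((real \<Rightarrow> 'a measure) \<times> (real \<Rightarrow> ('a \<times> 'a) flux)) set" where
  "ACE \<pi> \<kappa> \<phi> \<psi>s \<alpha> T = {(\<rho>, j). (\<rho>, j) \<in> CE T
   \<and> (SUP t\<in>{0..T}. entropy \<pi> \<phi> (\<rho> t)) < \<infinity>
   \<and> (\<integral>\<^sup>+t\<in>{0..T}. (dissipation_potential \<pi> \<kappa> \<psi>s \<alpha> (\<rho> t) (j t)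
                     + fisher_information \<pi> \<kappa> \<phi> \<psi>s \<alpha> (\<rho> t)) \<partial>lborel) < \<infinity>}"

definition bounded_densities :: "'a measure \<Rightarrow> real \<Rightarrow> (real \<Rightarrow> 'a measure) \<Rightarrow> bool" where
  "bounded_densities \<pi> T \<rho> \<longleftrightarrow>
     (\<exists>C. AE t in lborel. t \<in> {0<..<T} \<longrightarrow> (AE x in \<pi>. measure_density \<pi> (\<rho> t) x \<le> C))"

definition RCE ::
    "'a::metric_space measure \<Rightarrow> ('a \<Rightarrow> 'a measure) \<Rightarrow> (real \<Rightarrow> real) \<Rightarrow> (real \<Rightarrow> real)
      \<Rightarrow> (real \<Rightarrow> real \<Rightarrow> real) \<Rightarrow> real
      \<Rightarrow> ((real \<Rightarrow> 'a measure) \<times> (real \<Rightarrow> ('a \<times> 'a) flux)) set" where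
  "RCE \<pi> \<kappa> \<phi> \<psi>s \<alpha> T = {(\<rho>, j). (\<rho>, j) \<in> ACE \<pi> \<kappa> \<phi> \<psi>s \<alpha> T
   \<and> bounded_densities \<pi> T \<rho>
   \<and> (\<forall>f \<in> X2 \<pi> \<kappa>. tested_continuity_equation T \<rho> j f)}"

end

theory Submission
  imports Defs
begin

text \<open>
  For \<open>f\<close> in \<open>X2\<close> with \<open>\<bar>f\<bar> \<le> C\<close>, clip a Lipschitz approximation at height \<open>C\<close> to get \<open>G\<^sub>n\<close>; then still
  \<open>\<nabla>G\<^sub>n \<longlongrightarrow> \<nabla>f\<close> in \<open>L\<^sup>2(\<theta>)\<close>, and in addition all \<open>\<nabla>G\<^sub>n - \<nabla>f\<close> are bounded by \<open>4 C\<close>. Since \<open>\<psi>s\<close> is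
  quadratic near 0 and \<open>\<alpha>\<close> is bounded on the range of the densities, the Fenchel--Young inequality gives,
  for bounded \<open>g\<close> and every \<open>s > 0\<close>,
  \<open>s \<integral>\<integral>\<bar>g\<bar>d\<bar>j\<^sub>t\<bar>dt \<le> \<integral>R(\<rho>\<^sub>t, j\<^sub>t)dt + c\<^sub>s \<parallel>g\<parallel>\<^sup>2\<close>. With \<open>g = \<nabla>G\<^sub>n - \<nabla>f\<close>, letting \<open>n \<longlongrightarrow> \<infinity>\<close> and then \<open>s \<longlongrightarrow> \<infinity>\<close>
  shows \<open>\<integral>\<integral>\<bar>\<nabla>G\<^sub>n - \<nabla>f\<bar>d\<bar>j\<^sub>t\<bar>dt \<longlongrightarrow> 0\<close>, so the continuity equation passes to the limit on the flux side;
  on the other side dominated convergence applies because \<open>\<rho>\<^sub>t \<lless> \<pi>\<close> for every \<open>t\<close>.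
\<close>

section \<open>Fluxes and their total variation\<close>

lemma sets_total_variation [simp, measurable_cong]: "sets (total_variation \<mu>) = sets borel"
  and space_total_variation [simp]: "space (total_variation \<mu>) = UNIV"
  using sets.sigma_sets_eq[of borel]
  by (simp_all add: total_variation_def space_measure_of_conv)

text \<open>\<open>measure_of\<close> returns the prescribed set function only if it is countably
  additive; here this is inherited from the two parts, because series of nonnegative terms add
  termwise.\<close>

lemma emeasure_total_variation:
  assumes "sets (fst \<mu>) = sets borel" "sets (snd \<mu>) = sets borel" "B \<in> sets borel"
  shows "emeasure (total_variation \<mu>) B = emeasure (fst \<mu>) B + emeasure (snd \<mu>) B"
proof (rule emeasure_measure_of[OF total_variation_def])
  show "countably_additive (sets (total_variation \<mu>)) (\<lambda>B. emeasure (fst \<mu>) B + emeasure (snd \<mu>) B)"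
  proof (rule countably_additiveI)
    fix A :: "nat \<Rightarrow> 'a set"
    assume "range A \<subseteq> sets (total_variation \<mu>)" "disjoint_family A"
    then show "(\<Sum>i. emeasure (fst \<mu>) (A i) + emeasure (snd \<mu>) (A i))
        = emeasure (fst \<mu>) (\<Union> (range A)) + emeasure (snd \<mu>) (\<Union> (range A))"
      using assms by (subst suminf_add[symmetric]) (auto simp: suminf_emeasure)
  qed
qed (use assms in \<open>auto simp: positive_def\<close>)

lemma nn_integral_total_variation:
  assumes "sets (fst \<mu>) = sets borel" "sets (snd \<mu>) = sets borel" "g \<in> borel_measurable borel"
  shows "(\<integral>\<^sup>+z. g z \<partial>total_variation \<mu>) = (\<integral>\<^sup>+z. g z \<partial>fst \<mu>) + (\<integral>\<^sup>+z. g z \<partial>snd \<mu>)"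
  using assms(3)
proof (induction rule: borel_measurable_induct)
  note [measurable_cong] = assms(1,2)
  {
    case (cong f g)
    then show ?case by (simp cong: nn_integral_cong)
  next
    case (set A)
    then show ?case
      using assms by (simp add: emeasure_total_variation)
  next
    case (mult u c)
    then show ?case by (simp add: nn_integral_cmult distrib_left)
  next
    case (add u v)
    then show ?case by (simp add: nn_integral_add algebra_simps)
  next
    case (seq U)
    have inc: "incseq U" by fact
    have [measurable]: "\<And>i. U i \<in> borel_measurable borel" using seq by auto
    have e: "(\<integral>\<^sup>+z. (SUP i. U i) z \<partial>M) = (SUP i. \<integral>\<^sup>+z. U i z \<partial>M)"
      if "sets M = sets borel" for M :: "'a measure"
    proof -
      note [measurable_cong] = that
      show ?thesis using nn_integral_monotone_convergence_SUP[OF inc, of M] by (simp add: image_image)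
    qed
    show ?case
      unfolding e[OF assms(1)] e[OF assms(2)] e[OF sets_total_variation] seq
      by (intro ennreal_SUP_add incseq_SucI incseq_nn_integral inc)
         (auto intro!: nn_integral_mono simp: le_funD incseq_SucD[OF inc])
  }
qed

section \<open>Measurable dependence of integrals on a parameter\<close>

text \<open>The measures \<open>M t\<close> may be infinite, so they need not form a subprobability
  kernel. Measurability is extended from indicators by linearity and monotone limits; it is used for
  the parts of a flux, with time as parameter.\<close>

lemma borel_measurable_nn_integral_family:
  assumes sets: "\<And>t. t \<in> space S \<Longrightarrow> sets (M t) = sets N"
    and em: "\<And>B. B \<in> sets N \<Longrightarrow> (\<lambda>t. emeasure (M t) B) \<in> borel_measurable S"
    and "g \<in> borel_measurable N"
  shows "(\<lambda>t. \<integral>\<^sup>+z. g z \<partial>M t) \<in> borel_measurable S"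
  using assms(3)
proof (induction rule: borel_measurable_induct)
  case (cong f g)
  have "(\<integral>\<^sup>+z. g z \<partial>M t) = (\<integral>\<^sup>+z. f z \<partial>M t)" if "t \<in> space S" for t
    using cong(3) sets_eq_imp_space_eq[OF sets[OF that]] by (intro nn_integral_cong) auto
  then show ?case by (rule measurable_cong[THEN iffD1, OF _ cong.IH])
next
  case (set A)
  have "(\<integral>\<^sup>+z. indicator A z \<partial>M t) = emeasure (M t) A" if "t \<in> space S" for t
    by (rule nn_integral_indicator) (simp add: set sets[OF that])
  from measurable_cong[THEN iffD2, OF this em[OF set]] show ?case .
next
  case (mult u c)
  have [measurable]: "(\<lambda>t. \<integral>\<^sup>+z. u z \<partial>M t) \<in> borel_measurable S" by (rule mult.IH)
  have *: "(\<integral>\<^sup>+z. c * u z \<partial>M t) = c * (\<integral>\<^sup>+z. u z \<partial>M t)" if "t \<in> space S" for t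
    using mult(2) measurable_cong_sets[OF sets[OF that] refl] by (intro nn_integral_cmult) blast
  show ?case by (rule measurable_cong[THEN iffD2, OF *]) measurable
next
  case (add u v)
  have [measurable]: "(\<lambda>t. \<integral>\<^sup>+z. u z \<partial>M t) \<in> borel_measurable S"
    "(\<lambda>t. \<integral>\<^sup>+z. v z \<partial>M t) \<in> borel_measurable S" by (rule add.IH)+
  have *: "(\<integral>\<^sup>+z. v z + u z \<partial>M t) = (\<integral>\<^sup>+z. v z \<partial>M t) + (\<integral>\<^sup>+z. u z \<partial>M t)"
    if "t \<in> space S" for t
    using \<open>u \<in> borel_measurable N\<close> \<open>v \<in> borel_measurable N\<close>
    by (intro nn_integral_add) (auto simp: measurable_cong_sets[OF sets[OF that] refl])
  show ?case by (rule measurable_cong[THEN iffD2, OF *]) measurable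
next
  case (seq U)
  have [measurable]: "(\<lambda>t. \<integral>\<^sup>+z. U i z \<partial>M t) \<in> borel_measurable S" for i by (rule seq.IH)
  have *: "(\<integral>\<^sup>+z. (SUP i. U i) z \<partial>M t) = (SUP i. \<integral>\<^sup>+z. U i z \<partial>M t)" if t: "t \<in> space S" for t
  proof -
    have "U i \<in> borel_measurable (M t)" for i
      using \<open>\<And>i. U i \<in> borel_measurable N\<close> by (simp add: measurable_cong_sets[OF sets[OF t] refl])
    from nn_integral_monotone_convergence_SUP[OF \<open>incseq U\<close> this] show ?thesis
      by (simp add: image_comp)
  qed
  show ?case by (rule measurable_cong[THEN iffD2, OF *]) measurable
qed

text \<open>The Bochner integral is a difference of two nonnegative integrals where \<open>g\<close>
  is integrable and the default 0 elsewhere. The distinction between the two cases is itself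
  measurable in \<open>t\<close>.\<close>

lemma borel_measurable_lebesgue_integral_family:
  fixes g :: "'b \<Rightarrow> real"
  assumes sets: "\<And>t. t \<in> space S \<Longrightarrow> sets (M t) = sets N"
    and em: "\<And>B. B \<in> sets N \<Longrightarrow> (\<lambda>t. emeasure (M t) B) \<in> borel_measurable S"
    and g [measurable]: "g \<in> borel_measurable N"
  shows "(\<lambda>t. LINT z|M t. g z) \<in> borel_measurable S"
proof -
  have nn: "(\<lambda>t. \<integral>\<^sup>+z. h z \<partial>M t) \<in> borel_measurable S" if "h \<in> borel_measurable N" for h
    by (rule borel_measurable_nn_integral_family[OF sets em that])
  have [measurable]: "(\<lambda>t. \<integral>\<^sup>+z. ennreal (g z) \<partial>M t) \<in> borel_measurable S"
    "(\<lambda>t. \<integral>\<^sup>+z. ennreal (- g z) \<partial>M t) \<in> borel_measurable S"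
    "(\<lambda>t. \<integral>\<^sup>+z. ennreal \<bar>g z\<bar> \<partial>M t) \<in> borel_measurable S"
    by (rule nn; measurable)+
  have *: "(LINT z|M t. g z) = (if (\<integral>\<^sup>+z. ennreal \<bar>g z\<bar> \<partial>M t) < \<infinity>
      then enn2real (\<integral>\<^sup>+z. ennreal (g z) \<partial>M t) - enn2real (\<integral>\<^sup>+z. ennreal (- g z) \<partial>M t) else 0)"
    if "t \<in> space S" for t
  proof -
    have "g \<in> borel_measurable (M t)" using sets[OF that] g measurable_cong_sets by blast
    then show ?thesis
      by (auto simp: real_lebesgue_integral_def integrable_iff_bounded not_integrable_integral_eq)
  qed
  show ?thesis by (rule measurable_cong[THEN iffD2, OF *]) measurable
qed

section \<open>The edge measure\<close>

lemma sets_edge_measure [simp, measurable_cong]: "sets (edge_measure \<pi> \<kappa>) = sets borel"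
  and space_edge_measure [simp]: "space (edge_measure \<pi> \<kappa>) = UNIV"
  using sets.sigma_sets_eq[of borel]
  by (simp_all add: edge_measure_def space_measure_of_conv)

text \<open>Only an inequality, so that the measurability of \<open>x \<mapsto> \<kappa> x {y. (x, y) \<in> B}\<close> need not be
  discussed: where \<^const>\<open>measure_of\<close> is not given a measure it returns the null measure.\<close>

lemma emeasure_edge_measure_le:
  "emeasure (edge_measure \<pi> \<kappa>) B \<le> (\<integral>\<^sup>+x. emeasure (\<kappa> x) {y. (x, y) \<in> B} \<partial>\<pi>)"
  unfolding edge_measure_def by (subst emeasure_measure_of_conv) auto

lemma fst_borel_measurable: "fst \<in> borel_measurable (borel :: ('a::topological_space \<times> 'b::topological_space) measure)"
  and snd_borel_measurable: "snd \<in> borel_measurable (borel :: ('a::topological_space \<times> 'b::topological_space) measure)"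
  by (intro borel_measurable_continuous_onI continuous_intros)+

text \<open>For a \<open>\<pi>\<close>-null set \<open>N\<close>, the sections of the strip over
  \<open>N\<close> are empty at every point outside \<open>N\<close>, so the upper bound for the
  edge measure of the strip is an integral that vanishes.\<close>

lemma AE_edge_measure_fst:
  fixes \<pi> :: "'a::{second_countable_topology} measure"
  assumes \<pi>: "sets \<pi> = sets borel" and P: "AE x in \<pi>. P x"
  shows "AE z in edge_measure \<pi> \<kappa>. P (fst z)"
proof -
  obtain N where N: "N \<in> null_sets \<pi>" "{x \<in> space \<pi>. \<not> P x} \<subseteq> N"
    using P by (auto simp: eventually_ae_filter)
  have [simp]: "space \<pi> = UNIV" using sets_eq_imp_space_eq[OF \<pi>] by simp
  have "emeasure (edge_measure \<pi> \<kappa>) (fst -` N) \<le> (\<integral>\<^sup>+x. emeasure (\<kappa> x) {y. (x, y) \<in> fst -` N} \<partial>\<pi>)"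
    by (rule emeasure_edge_measure_le)
  also have "\<dots> \<le> (\<integral>\<^sup>+x. 0 \<partial>\<pi>)"
    using AE_not_in[OF N(1)] by (intro nn_integral_mono_AE) auto
  finally have "emeasure (edge_measure \<pi> \<kappa>) (fst -` N) = 0" by simp
  moreover have "fst -` N \<in> sets (borel :: ('a \<times> 'a) measure)"
    using N(1) \<pi> measurable_sets[OF fst_borel_measurable, of N]
    by auto
  ultimately have "fst -` N \<in> null_sets (edge_measure \<pi> \<kappa>)" by auto
  then show ?thesis by (rule AE_I') (use N in auto)
qed

lemma swap_measurable [measurable]:
  "prod.swap \<in> borel_measurable (borel :: ('a::second_countable_topology \<times> 'a) measure)"
  by (intro borel_measurable_continuous_onI continuous_on_swap)

text \<open>Detailed balance reduces this to the first coordinate: swapping preserves the edge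
  measure and exchanges the projections.\<close>

lemma AE_edge_measure_snd:
  fixes \<pi> :: "'a::{second_countable_topology} measure"
  assumes "sets \<pi> = sets borel" "distr (edge_measure \<pi> \<kappa>) borel prod.swap = edge_measure \<pi> \<kappa>"
    and "AE x in \<pi>. P x"
  shows "AE z in edge_measure \<pi> \<kappa>. P (snd z)"
proof -
  have "AE z in distr (edge_measure \<pi> \<kappa>) borel prod.swap. P (fst z)"
    using AE_edge_measure_fst[OF assms(1,3)] assms(2) by metis
  then have "AE z in edge_measure \<pi> \<kappa>. P (fst (prod.swap z))"
    by (rule AE_distrD[rotated]) measurable
  then show ?thesis by simp
qed

lemma off_diagonal_borel [measurable]: "off_diagonal \<in> sets (borel :: ('a::t2_space \<times> 'a) measure)"
proof -
  have "(off_diagonal :: ('a \<times> 'a) set) = - {z. fst z = snd z}" by (auto simp: off_diagonal_def)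
  moreover have "closed {z :: 'a \<times> 'a. fst z = snd z}"
    by (intro closed_Collect_eq continuous_intros)
  ultimately show ?thesis by (metis borel_open open_Compl)
qed

text \<open>By a Chebyshev estimate with the uniform second moment bound, the jumps longer than
  \<open>1 / Suc n\<close> have finite mass. These sets and the null diagonal cover the space. This
  supports the Radon-Nikodym derivatives with respect to the weighted edge measure.\<close>

lemma sigma_finite_edge_measure:
  fixes \<pi> :: "'a::{metric_space, second_countable_topology} measure"
  assumes J: "jump_setting \<pi> \<kappa>"
  shows "sigma_finite_measure (edge_measure \<pi> \<kappa>)"
proof
  have \<pi>: "finite_measure \<pi>"
    and \<kappa>: "\<And>x. sets (\<kappa> x) = sets borel" "\<And>x. emeasure (\<kappa> x) {x} = 0"
    using J by (auto simp: jump_setting_def finite_borel_measures_def sigma_finite_borel_measures_def)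
  define S where "S = (SUP x. \<integral>\<^sup>+y. ennreal (min 1 ((dist x y)\<^sup>2)) \<partial>\<kappa> x)"
  have S: "S < \<infinity>" using J by (simp add: jump_setting_def S_def)
  define D where "D n = {z :: 'a \<times> 'a. 1 / Suc n < dist (fst z) (snd z)}" for n :: nat
  have D [measurable]: "D n \<in> sets borel" for n
    unfolding D_def by (intro borel_open open_Collect_less continuous_intros)
  have *: "emeasure (\<kappa> x) {y. (x, y) \<in> D n} \<le> ennreal ((real (Suc n))\<^sup>2) * S" for n x
  proof -
    note [measurable_cong] = \<kappa>(1)
    have [simp]: "space (\<kappa> x) = UNIV" using sets_eq_imp_space_eq[OF \<kappa>(1)] by simp
    have "emeasure (\<kappa> x) {y. (x, y) \<in> D n} = (\<integral>\<^sup>+y. indicator {y. (x, y) \<in> D n} y \<partial>\<kappa> x)"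
      by (rule nn_integral_indicator[symmetric]) (simp add: D_def \<kappa>(1))
    also have "\<dots> \<le> (\<integral>\<^sup>+y. ennreal ((real (Suc n))\<^sup>2) * ennreal (min 1 ((dist x y)\<^sup>2)) \<partial>\<kappa> x)"
    proof (rule nn_integral_mono)
      fix y
      \<comment> \<open>Each branch of the minimum is handled separately: the factor alone is at
        least 1, and so is its product with the squared distance.\<close>
      have "1 \<le> (real (Suc n))\<^sup>2 * min 1 ((dist x y)\<^sup>2)" if "1 / Suc n < dist x y"
      proof -
        have a: "1 \<le> real (Suc n) * dist x y" using that by (simp add: field_simps)
        have "1 \<le> (real (Suc n))\<^sup>2" by (simp add: power2_eq_square algebra_simps)
        moreover have "1 \<le> (real (Suc n) * dist x y)\<^sup>2" using a by (rule one_le_power)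
        ultimately show ?thesis by (auto simp: min_def power_mult_distrib)
      qed
      then show "indicator {y. (x, y) \<in> D n} y
          \<le> ennreal ((real (Suc n))\<^sup>2) * ennreal (min 1 ((dist x y)\<^sup>2))"
        by (auto simp: D_def indicator_def ennreal_mult[symmetric] simp del: of_nat_Suc
            intro!: ennreal_leI simp flip: ennreal_1)
    qed
    also have "\<dots> = ennreal ((real (Suc n))\<^sup>2) * (\<integral>\<^sup>+y. ennreal (min 1 ((dist x y)\<^sup>2)) \<partial>\<kappa> x)"
      by (rule nn_integral_cmult) measurable
    also have "\<dots> \<le> ennreal ((real (Suc n))\<^sup>2) * S"
      unfolding S_def by (intro mult_left_mono SUP_upper) auto
    finally show ?thesis .
  qed
  have Dfin: "emeasure (edge_measure \<pi> \<kappa>) (D n) \<noteq> \<infinity>" for n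
  proof -
    have "emeasure (edge_measure \<pi> \<kappa>) (D n) \<le> (\<integral>\<^sup>+x. emeasure (\<kappa> x) {y. (x, y) \<in> D n} \<partial>\<pi>)"
      by (rule emeasure_edge_measure_le)
    also have "\<dots> \<le> (\<integral>\<^sup>+x. ennreal ((real (Suc n))\<^sup>2) * S \<partial>\<pi>)"
      by (rule nn_integral_mono) (rule *)
    also have "\<dots> < \<infinity>"
      using S finite_measure.emeasure_finite[OF \<pi>, of "space \<pi>"]
      by (simp add: ennreal_mult_less_top less_top)
    finally show ?thesis by simp
  qed
  have diag: "emeasure (edge_measure \<pi> \<kappa>) (- off_diagonal) \<noteq> \<infinity>"
  proof -
    have "{y. (x, y) \<in> - off_diagonal} = {x}" for x :: 'a by (auto simp: off_diagonal_def)
    then have "emeasure (edge_measure \<pi> \<kappa>) (- off_diagonal) \<le> 0"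
      using emeasure_edge_measure_le[of \<pi> \<kappa> "- off_diagonal"] \<kappa>(2) by simp
    then show ?thesis by auto
  qed
  have cover: "z \<in> \<Union> (insert (- off_diagonal) (range D))" for z :: "'a \<times> 'a"
  proof (cases "z \<in> off_diagonal")
    case True
    then have "0 < dist (fst z) (snd z)" by (auto simp: off_diagonal_def)
    then obtain n where "1 / Suc n < dist (fst z) (snd z)"
      using nat_approx_posE by blast
    then show ?thesis by (auto simp: D_def)
  qed auto
  show "\<exists>A. countable A \<and> A \<subseteq> sets (edge_measure \<pi> \<kappa>) \<and> \<Union> A = space (edge_measure \<pi> \<kappa>) \<and>
      (\<forall>a\<in>A. emeasure (edge_measure \<pi> \<kappa>) a \<noteq> \<infinity>)"
    using cover Dfin diag
    by (intro exI[of _ "insert (- off_diagonal) (range D)"])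
       (auto intro!: borel_comp off_diagonal_borel)
qed

section \<open>Bounds and measurability of the densities\<close>

text \<open>Near 0 the limit of the quotient gives the factor \<open>c0 + 1\<close>. For
  \<open>\<bar>\<xi>\<bar>\<close> between \<open>\<delta>\<close> and \<open>K\<close>, compactness
  bounds \<open>\<psi>s\<close> by \<open>B\<close>, and \<open>B\<close> is at most
  \<open>B / \<delta>\<^sup>2 * \<xi>\<^sup>2\<close>. The factor depends on \<open>K\<close>, which
  is why bounded gradients matter later.\<close>

lemma dual_dissipation_density_quadratic_bound:
  assumes "dual_dissipation_density \<psi>s"
  obtains c where "c \<ge> 0" "\<And>\<xi>. \<bar>\<xi>\<bar> \<le> K \<Longrightarrow> \<psi>s \<xi> \<le> c * \<xi>\<^sup>2"
proof -
  have z: "\<psi>s 0 = 0" and cont: "continuous_on UNIV \<psi>s"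
    using assms by (auto simp: dual_dissipation_density_def intro: differentiable_imp_continuous_on)
  obtain c0 where "c0 > 0" and lim: "((\<lambda>\<xi>. \<psi>s \<xi> / \<bar>\<xi>\<bar>\<^sup>2) \<longlongrightarrow> c0) (at 0)"
    using assms by (auto simp: dual_dissipation_density_def)
  have "\<forall>\<^sub>F \<xi> in at 0. \<psi>s \<xi> / \<bar>\<xi>\<bar>\<^sup>2 < c0 + 1"
    using order_tendstoD(2)[OF lim, of "c0 + 1"] by simp
  then obtain \<delta> where \<delta>: "\<delta> > 0" "\<And>\<xi>. \<xi> \<noteq> 0 \<Longrightarrow> \<bar>\<xi>\<bar> < \<delta> \<Longrightarrow> \<psi>s \<xi> / \<bar>\<xi>\<bar>\<^sup>2 < c0 + 1"
    by (auto simp: eventually_at dist_real_def)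
  have "bounded (\<psi>s ` {-K..K})"
    by (intro compact_imp_bounded compact_continuous_image continuous_on_subset[OF cont]) auto
  then obtain B where B: "B > 0" "\<And>\<xi>. \<bar>\<xi>\<bar> \<le> K \<Longrightarrow> \<bar>\<psi>s \<xi>\<bar> \<le> B"
    by (force simp: bounded_pos)
  show thesis
  proof
    show "0 \<le> c0 + 1 + B / \<delta>\<^sup>2" using \<open>c0 > 0\<close> B by (intro add_nonneg_nonneg) auto
    fix \<xi> assume K: "\<bar>\<xi>\<bar> \<le> K"
    show "\<psi>s \<xi> \<le> (c0 + 1 + B / \<delta>\<^sup>2) * \<xi>\<^sup>2"
    proof (cases "\<bar>\<xi>\<bar> < \<delta>")
      case True
      have "\<psi>s \<xi> \<le> (c0 + 1) * \<xi>\<^sup>2"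
        using \<delta>(2)[of \<xi>] True z by (cases "\<xi> = 0") (auto simp: field_simps)
      also have "\<dots> \<le> (c0 + 1 + B / \<delta>\<^sup>2) * \<xi>\<^sup>2" using B by (intro mult_right_mono) auto
      finally show ?thesis .
    next
      case False
      have "\<psi>s \<xi> \<le> B" using B(2)[OF K] by simp
      also have "\<dots> \<le> B / \<delta>\<^sup>2 * \<xi>\<^sup>2"
      proof -
        have "\<delta>\<^sup>2 \<le> \<bar>\<xi>\<bar>\<^sup>2" using False \<delta>(1) by (intro power_mono) auto
        then have "B * \<delta>\<^sup>2 \<le> B * \<xi>\<^sup>2" using B(1) by (intro mult_left_mono) auto
        then show ?thesis using \<delta>(1) by (simp add: field_simps)
      qed
      also have "\<dots> \<le> (c0 + 1 + B / \<delta>\<^sup>2) * \<xi>\<^sup>2" using \<open>c0 > 0\<close> by (intro mult_right_mono) auto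
      finally show ?thesis .
    qed
  qed
qed

lemma measure_density_borel_measurable:
  "sets \<pi> = sets borel \<Longrightarrow> measure_density \<pi> \<rho> \<in> borel_measurable borel"
  unfolding measure_density_def using borel_measurable_RN_deriv[of \<pi> \<rho>]
  by (simp cong: measurable_cong_sets)

text \<open>Continuity of \<open>\<alpha>\<close> is known on the closed quadrant only, so
  \<open>\<alpha>\<close> is extended by 0; nonnegativity of \<open>u\<close> makes the extension
  invisible.\<close>

lemma mobility_density_borel_measurable:
  fixes u :: "'a::second_countable_topology \<Rightarrow> real"
  assumes \<alpha>: "mobility_density \<alpha>" and u [measurable]: "u \<in> borel_measurable borel"
    and nn: "\<And>x. 0 \<le> u x"
  shows "(\<lambda>(x, y). ennreal (\<alpha> (u x) (u y))) \<in> borel_measurable borel"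
proof -
  let ?h = "\<lambda>p. indicator ({0..} \<times> {0..}) p *\<^sub>R (\<lambda>(u, v). \<alpha> u v) p"
  have h: "?h \<in> borel_measurable borel"
    using \<alpha> unfolding mobility_density_def
    by (intro borel_measurable_continuous_on_indicator borel_closed closed_Times) auto
  have g: "(\<lambda>z :: 'a \<times> 'a. (u (fst z), u (snd z))) \<in> borel_measurable borel"
    by (intro borel_measurable_Pair measurable_compose[OF fst_borel_measurable u]
        measurable_compose[OF snd_borel_measurable u])
  have "(\<lambda>z :: 'a \<times> 'a. ennreal (?h (u (fst z), u (snd z)))) \<in> borel_measurable borel"
    using measurable_compose[OF g h] by (rule measurable_compose) measurable
  then show ?thesis by (simp add: nn case_prod_beta)
qed

section \<open>Bounding the flux by the dissipation\<close>

lemma fluxesD: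
  assumes "j \<in> fluxes"
  shows "sets (fst j) = sets borel" "sets (snd j) = sets borel"
    "sigma_finite_measure (fst j)" "sigma_finite_measure (snd j)" "mutually_singular (fst j) (snd j)"
  using assms unfolding fluxes_def sigma_finite_borel_measures_def by (cases j; simp)+

lemma sigma_finite_scale_measure_2:
  assumes "sigma_finite_measure M"
  shows "sigma_finite_measure (scale_measure 2 M)"
proof
  obtain A where "countable A" "A \<subseteq> sets M" "\<Union> A = space M" "\<forall>a\<in>A. emeasure M a \<noteq> \<infinity>"
    using assms by (auto simp: sigma_finite_measure_def)
  then show "\<exists>A. countable A \<and> A \<subseteq> sets (scale_measure 2 M) \<and> \<Union> A = space (scale_measure 2 M) \<and>
      (\<forall>a\<in>A. emeasure (scale_measure 2 M) a \<noteq> \<infinity>)"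
    by (intro exI[of _ A]) (auto simp: space_scale_measure ennreal_mult_eq_top_iff)
qed

text \<open>As a supremum of functions continuous in \<open>s\<close>, the conjugate is lower
  semicontinuous: its strict superlevel sets are unions of open sets.\<close>

lemma convex_conjugate_borel_measurable:
  assumes "continuous_on UNIV f"
  shows "convex_conjugate f \<in> borel_measurable borel"
proof (rule borel_measurableI_greater)
  fix y :: ereal
  have "{s. y < convex_conjugate f s} = (\<Union>\<xi>. {s. y < ereal (s * \<xi> - f \<xi>)})"
    by (auto simp: convex_conjugate_def less_SUP_iff)
  moreover have "open {s. y < ereal (s * \<xi> - f \<xi>)}" for \<xi>
    by (intro open_Collect_less continuous_intros)
  ultimately have "open {s. y < convex_conjugate f s}" by auto
  then show "{s \<in> space borel. y < convex_conjugate f s} \<in> sets borel" by simp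
qed

lemma fenchel_young_abs:
  assumes even: "\<And>\<xi>. f (- \<xi>) = f \<xi>" and nn: "\<And>\<xi>. 0 \<le> f \<xi>"
  shows "ennreal (\<bar>s\<bar> * \<bar>\<xi>\<bar>) \<le> e2ennreal (convex_conjugate f s) + ennreal (f \<xi>)"
proof -
  \<comment> \<open>Evenness allows the sign of \<open>\<xi>\<close> to be matched to that of
    \<open>s\<close>, so that the product becomes the product of absolute values.\<close>
  define \<zeta> where "\<zeta> = (if s < 0 then - \<bar>\<xi>\<bar> else \<bar>\<xi>\<bar>)"
  have \<zeta>: "s * \<zeta> = \<bar>s\<bar> * \<bar>\<xi>\<bar>" "f \<zeta> = f \<xi>" by (auto simp: \<zeta>_def abs_if even)
  have "ereal (s * \<zeta> - f \<zeta>) \<le> convex_conjugate f s"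
    unfolding convex_conjugate_def by (rule SUP_upper) simp
  then have "ennreal (\<bar>s\<bar> * \<bar>\<xi>\<bar> - f \<xi>) \<le> e2ennreal (convex_conjugate f s)"
    unfolding \<zeta> by (metis e2ennreal_ereal e2ennreal_mono)
  \<comment> \<open>\<open>ennreal\<close> sends negative numbers to 0, so the case where
    \<open>f \<xi>\<close> exceeds the product is separate; there \<open>f \<xi>\<close> alone
    suffices.\<close>
  moreover have "ennreal (\<bar>s\<bar> * \<bar>\<xi>\<bar>) \<le> ennreal (\<bar>s\<bar> * \<bar>\<xi>\<bar> - f \<xi>) + ennreal (f \<xi>)"
  proof (cases "f \<xi> \<le> \<bar>s\<bar> * \<bar>\<xi>\<bar>")
    case True
    then show ?thesis using nn[of \<xi>] by (simp flip: ennreal_plus)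
  next
    case False
    then have "ennreal (\<bar>s\<bar> * \<bar>\<xi>\<bar>) \<le> ennreal (f \<xi>)" by (intro ennreal_leI) simp
    then show ?thesis by (simp add: add_increasing)
  qed
  ultimately show ?thesis by (meson add_right_mono order_trans)
qed

text \<open>The Fenchel-Young inequality is applied pointwise to the density of the doubled flux and
  to \<open>g\<close>, then integrated. Mutual singularity of the two parts turns the sum of their
  densities into the absolute value of their difference.\<close>

lemma nn_integral_total_variation_young:
  assumes j: "j \<in> fluxes" and sf: "sigma_finite_measure \<nu>" and \<nu> [measurable_cong]: "sets \<nu> = sets borel"
    and ac: "absolutely_continuous \<nu> (total_variation j)"
    and \<psi>s: "dual_dissipation_density \<psi>s" and g [measurable]: "g \<in> borel_measurable borel"
  shows "2 * (\<integral>\<^sup>+z. ennreal \<bar>g z\<bar> \<partial>total_variation j)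
    \<le> (\<integral>\<^sup>+z. e2ennreal (convex_conjugate \<psi>s (flux_density \<nu> (double_flux j) z)) \<partial>\<nu>)
      + (\<integral>\<^sup>+z. ennreal (\<psi>s (g z)) \<partial>\<nu>)"
proof -
  interpret \<nu>: sigma_finite_measure \<nu> by (rule sf)
  have [simp]: "space \<nu> = UNIV" using sets_eq_imp_space_eq[OF \<nu>] by simp
  have cont: "continuous_on UNIV \<psi>s" and even: "\<And>\<xi>. \<psi>s (- \<xi>) = \<psi>s \<xi>" and nn: "\<And>\<xi>. 0 \<le> \<psi>s \<xi>"
    using \<psi>s by (auto simp: dual_dissipation_density_def intro: differentiable_imp_continuous_on)
  have [measurable]: "convex_conjugate \<psi>s \<in> borel_measurable borel" "\<psi>s \<in> borel_measurable borel"
    using convex_conjugate_borel_measurable[OF cont] borel_measurable_continuous_onI[OF cont] by auto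
  have js: "sets (fst j) = sets borel" "sets (snd j) = sets borel"
    and jsf: "sigma_finite_measure (fst j)" "sigma_finite_measure (snd j)"
    using fluxesD[OF j] by simp_all
  note [measurable_cong] = js
  have jsp: "space (snd j) = UNIV" using sets_eq_imp_space_eq[OF js(2)] by simp
  obtain A where A [measurable]: "A \<in> sets borel" and A0: "emeasure (fst j) A = 0" "emeasure (snd j) (UNIV - A) = 0"
    using fluxesD(5)[OF j] unfolding mutually_singular_def jsp js by blast
  define a where "a = RN_deriv \<nu> (scale_measure 2 (fst j))"
  define b where "b = RN_deriv \<nu> (scale_measure 2 (snd j))"
  have [measurable]: "a \<in> borel_measurable borel" "b \<in> borel_measurable borel"
    unfolding a_def b_def using borel_measurable_RN_deriv \<nu> measurable_cong_sets by blast+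
  have ac': "absolutely_continuous \<nu> (scale_measure 2 (fst j))" "absolutely_continuous \<nu> (scale_measure 2 (snd j))"
    using ac \<nu> js emeasure_total_variation[OF js]
    by (auto simp: absolutely_continuous_def null_sets_def subset_eq)
  have a: "density \<nu> a = scale_measure 2 (fst j)" and b: "density \<nu> b = scale_measure 2 (snd j)"
    unfolding a_def b_def by (intro \<nu>.density_RN_deriv ac'; simp add: js \<nu>)+
  \<comment> \<open>Finiteness is essential because \<open>flux_density\<close> passes through
    \<open>enn2real\<close>, which sends infinity to 0.\<close>
  have fin: "AE z in \<nu>. a z \<noteq> \<infinity>" "AE z in \<nu>. b z \<noteq> \<infinity>"
    unfolding a_def b_def
    by (intro \<nu>.RN_deriv_finite sigma_finite_scale_measure_2 jsf ac'; simp add: js \<nu>)+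
  have "emeasure (density \<nu> a) A = 0" "emeasure (density \<nu> b) (UNIV - A) = 0"
    unfolding a b using A0 by simp_all
  then have sing: "AE z in \<nu>. a z * indicator A z = 0" "AE z in \<nu>. b z * indicator (UNIV - A) z = 0"
    by (simp_all add: emeasure_density nn_integral_0_iff_AE \<nu>)
  have "2 * (\<integral>\<^sup>+z. ennreal \<bar>g z\<bar> \<partial>total_variation j)
      = (\<integral>\<^sup>+z. ennreal \<bar>g z\<bar> \<partial>scale_measure 2 (fst j)) + (\<integral>\<^sup>+z. ennreal \<bar>g z\<bar> \<partial>scale_measure 2 (snd j))"
    by (simp add: nn_integral_total_variation[OF js] nn_integral_scale_measure distrib_left)
  also have "\<dots> = (\<integral>\<^sup>+z. a z * ennreal \<bar>g z\<bar> \<partial>\<nu>) + (\<integral>\<^sup>+z. b z * ennreal \<bar>g z\<bar> \<partial>\<nu>)"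
    unfolding a[symmetric] b[symmetric] by (simp add: nn_integral_density)
  also have "\<dots> = (\<integral>\<^sup>+z. a z * ennreal \<bar>g z\<bar> + b z * ennreal \<bar>g z\<bar> \<partial>\<nu>)"
    by (rule nn_integral_add[symmetric]) measurable
  also have "\<dots> \<le> (\<integral>\<^sup>+z. e2ennreal (convex_conjugate \<psi>s (flux_density \<nu> (double_flux j) z)) + ennreal (\<psi>s (g z)) \<partial>\<nu>)"
    using fin sing
  proof (intro nn_integral_mono_AE, eventually_elim)
    fix z
    assume fin: "a z \<noteq> \<infinity>" "b z \<noteq> \<infinity>" and sing: "a z * indicator A z = 0" "b z * indicator (UNIV - A) z = 0"
    define w where "w = enn2real (a z) - enn2real (b z)"
    have w: "flux_density \<nu> (double_flux j) z = w"
      by (simp add: flux_density_def measure_density_def double_flux_def w_def a_def b_def)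
    \<comment> \<open>The set \<open>A\<close> separates the parts: \<open>a\<close> vanishes on it
      and \<open>b\<close> off it, so at each such point at most one term survives.\<close>
    have "a z + b z = ennreal \<bar>w\<bar>"
    proof (cases "z \<in> A")
      case True
      then show ?thesis using sing fin by (simp add: w_def less_top)
    next
      case False
      then show ?thesis using sing fin by (simp add: w_def less_top)
    qed
    then have "a z * ennreal \<bar>g z\<bar> + b z * ennreal \<bar>g z\<bar> = ennreal (\<bar>w\<bar> * \<bar>g z\<bar>)"
      by (simp add: ennreal_mult flip: distrib_right)
    then show "a z * ennreal \<bar>g z\<bar> + b z * ennreal \<bar>g z\<bar>
        \<le> e2ennreal (convex_conjugate \<psi>s (flux_density \<nu> (double_flux j) z)) + ennreal (\<psi>s (g z))"
      unfolding w using fenchel_young_abs[of \<psi>s, OF even nn] by simp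
  qed
  also have "\<dots> = (\<integral>\<^sup>+z. e2ennreal (convex_conjugate \<psi>s (flux_density \<nu> (double_flux j) z)) \<partial>\<nu>)
      + (\<integral>\<^sup>+z. ennreal (\<psi>s (g z)) \<partial>\<nu>)"
    by (rule nn_integral_add)
       (simp_all add: flux_density_def measure_density_def double_flux_def flip: a_def b_def)
  finally show ?thesis .
qed

lemma half_mult_two_ennreal: "1 / 2 * (2 * x) = (x :: ennreal)"
proof -
  have "1 / 2 * (2 :: ennreal) = 1"
    using ennreal_divide_self[of "2 :: ennreal"] by (simp add: divide_ennreal_def mult.commute)
  then show ?thesis by (simp add: mult.assoc[symmetric])
qed

text \<open>The bound at a fixed time: densities at most \<open>C\<close> give mobility at most
  \<open>A\<close>, and \<open>\<bar>g\<bar> \<le> K\<close> gives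
  \<open>\<psi>s (g z) \<le> c * (g z)\<^sup>2\<close>, so the dual term of the Young inequality is
  controlled by the squared \<open>L\<^sup>2\<close> norm of \<open>g\<close>.\<close>

lemma nn_integral_total_variation_le_dissipation:
  fixes \<pi> :: "'a::{metric_space, second_countable_topology} measure"
  assumes J: "jump_setting \<pi> \<kappa>" and \<psi>s: "dual_dissipation_density \<psi>s" and \<alpha>: "mobility_density \<alpha>"
    and j: "j \<in> fluxes"
    and u: "AE x in \<pi>. measure_density \<pi> \<rho> x \<le> C"
    and A: "A \<ge> 0" "\<And>p q. 0 \<le> p \<Longrightarrow> p \<le> C \<Longrightarrow> 0 \<le> q \<Longrightarrow> q \<le> C \<Longrightarrow> \<alpha> p q \<le> A"
    and c: "c \<ge> 0" "\<And>\<xi>. \<bar>\<xi>\<bar> \<le> K \<Longrightarrow> \<psi>s \<xi> \<le> c * \<xi>\<^sup>2"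
    and g [measurable]: "g \<in> borel_measurable borel" and K: "AE z in edge_measure \<pi> \<kappa>. \<bar>g z\<bar> \<le> K"
  shows "(\<integral>\<^sup>+z. ennreal \<bar>g z\<bar> \<partial>total_variation j)
    \<le> dissipation_potential \<pi> \<kappa> \<psi>s \<alpha> \<rho> j
      + 1 / 2 * (ennreal (A * c) * (\<integral>\<^sup>+z. ennreal ((g z)\<^sup>2) \<partial>edge_measure \<pi> \<kappa>))"
proof (cases "absolutely_continuous \<pi> \<rho> \<and> absolutely_continuous (weighted_edge_measure \<pi> \<kappa> \<alpha> \<rho>) (total_variation j)")
  \<comment> \<open>Here the dissipation potential is infinite by definition.\<close>
  case False
  then show ?thesis by (auto simp: dissipation_potential_def)
next
  case True
  define u where "u = measure_density \<pi> \<rho>"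
  define \<nu> where "\<nu> = weighted_edge_measure \<pi> \<kappa> \<alpha> \<rho>"
  define \<theta> where "\<theta> = edge_measure \<pi> \<kappa>"
  define W where "W = (\<lambda>(x, y). ennreal (\<alpha> (u x) (u y)))"
  have \<pi>: "sets \<pi> = sets borel" and sw: "distr (edge_measure \<pi> \<kappa>) borel prod.swap = edge_measure \<pi> \<kappa>"
    using J by (auto simp: jump_setting_def finite_borel_measures_def)
  have \<nu>_W: "\<nu> = density \<theta> W" by (simp add: \<nu>_def weighted_edge_measure_def \<theta>_def W_def u_def)
  have u_nn: "0 \<le> u x" for x by (simp add: u_def measure_density_def)
  have [measurable]: "W \<in> borel_measurable borel"
    unfolding W_def
    by (rule mobility_density_borel_measurable[OF \<alpha> _ u_nn])
       (simp add: u_def measure_density_borel_measurable[OF \<pi>])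
  have [measurable_cong]: "sets \<theta> = sets borel" by (simp add: \<theta>_def)
  interpret \<theta>: sigma_finite_measure \<theta> unfolding \<theta>_def by (rule sigma_finite_edge_measure[OF J])
  have sf: "sigma_finite_measure \<nu>"
  proof -
    have "W \<in> borel_measurable \<theta>" by measurable
    from \<theta>.sigma_finite_iff_density_finite[OF this] show ?thesis
      unfolding \<nu>_W by (auto simp: W_def)
  qed
  have [measurable]: "\<psi>s \<in> borel_measurable borel"
    using \<psi>s by (auto simp: dual_dissipation_density_def intro!: borel_measurable_continuous_onI differentiable_imp_continuous_on)
  have "(\<integral>\<^sup>+z. ennreal (\<psi>s (g z)) \<partial>\<nu>) = (\<integral>\<^sup>+z. W z * ennreal (\<psi>s (g z)) \<partial>\<theta>)"
    unfolding \<nu>_W by (rule nn_integral_density) measurable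
  also have "\<dots> \<le> (\<integral>\<^sup>+z. ennreal (A * c) * ennreal ((g z)\<^sup>2) \<partial>\<theta>)"
    using AE_edge_measure_fst[OF \<pi> u, of \<kappa>] AE_edge_measure_snd[OF \<pi> sw u] K
    unfolding \<theta>_def u_def[symmetric]
  proof (intro nn_integral_mono_AE, eventually_elim)
    fix z :: "'a \<times> 'a"
    assume z: "u (fst z) \<le> C" "u (snd z) \<le> C" "\<bar>g z\<bar> \<le> K"
    have "W z \<le> ennreal A" "ennreal (\<psi>s (g z)) \<le> ennreal (c * (g z)\<^sup>2)"
      using z A(2)[OF u_nn _ u_nn] c(2) by (auto simp: W_def case_prod_beta intro!: ennreal_leI)
    then have "W z * ennreal (\<psi>s (g z)) \<le> ennreal A * ennreal (c * (g z)\<^sup>2)" by (rule mult_mono) auto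
    then show "W z * ennreal (\<psi>s (g z)) \<le> ennreal (A * c) * ennreal ((g z)\<^sup>2)"
      using A(1) c(1) by (simp add: mult.assoc flip: ennreal_mult)
  qed
  also have "\<dots> = ennreal (A * c) * (\<integral>\<^sup>+z. ennreal ((g z)\<^sup>2) \<partial>\<theta>)"
    by (rule nn_integral_cmult) measurable
  finally have *: "(\<integral>\<^sup>+z. ennreal (\<psi>s (g z)) \<partial>\<nu>) \<le> ennreal (A * c) * (\<integral>\<^sup>+z. ennreal ((g z)\<^sup>2) \<partial>\<theta>)" .
  have \<nu>s: "sets \<nu> = sets borel" by (simp add: \<nu>_W \<theta>_def)
  have ac: "absolutely_continuous \<nu> (total_variation j)" using True by (simp add: \<nu>_def)
  have "(\<integral>\<^sup>+z. ennreal \<bar>g z\<bar> \<partial>total_variation j) = 1 / 2 * (2 * (\<integral>\<^sup>+z. ennreal \<bar>g z\<bar> \<partial>total_variation j))"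
    by (rule half_mult_two_ennreal[symmetric])
  also have "\<dots> \<le> 1 / 2 * ((\<integral>\<^sup>+z. e2ennreal (convex_conjugate \<psi>s (flux_density \<nu> (double_flux j) z)) \<partial>\<nu>)
      + ennreal (A * c) * (\<integral>\<^sup>+z. ennreal ((g z)\<^sup>2) \<partial>\<theta>))"
    using nn_integral_total_variation_young[OF j sf \<nu>s ac \<psi>s g] *
    by (intro mult_left_mono) (auto intro: order_trans add_left_mono)
  also have "\<dots> = dissipation_potential \<pi> \<kappa> \<psi>s \<alpha> \<rho> j + 1 / 2 * (ennreal (A * c) * (\<integral>\<^sup>+z. ennreal ((g z)\<^sup>2) \<partial>\<theta>))"
    using True by (simp add: dissipation_potential_def \<nu>_def Let_def distrib_left)
  finally show ?thesis by (simp add: \<theta>_def)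
qed

section \<open>Measurability in time and the time-integrated bound\<close>

lemma measurable_flux_familyD:
  assumes "measurable_flux_family T j" "t \<in> {0..T}"
  shows "sets (fst (j t)) = sets borel" "sets (snd (j t)) = sets borel"
  using assms fluxesD[of "j t"] by (simp_all add: measurable_flux_family_def)

lemma borel_measurable_total_variation_family:
  assumes j: "measurable_flux_family T j" and g: "g \<in> borel_measurable borel"
  shows "(\<lambda>t. \<integral>\<^sup>+z. g z \<partial>total_variation (j t)) \<in> borel_measurable (restrict_space borel {0..T})"
proof -
  have js: "sets (fst (j t)) = sets borel" "sets (snd (j t)) = sets borel" if "t \<in> {0..T}" for t
    using measurable_flux_familyD[OF j that] .
  have [measurable]: "(\<lambda>t. \<integral>\<^sup>+z. g z \<partial>fst (j t)) \<in> borel_measurable (restrict_space borel {0..T})"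
    "(\<lambda>t. \<integral>\<^sup>+z. g z \<partial>snd (j t)) \<in> borel_measurable (restrict_space borel {0..T})"
    using j js by (auto intro!: borel_measurable_nn_integral_family[OF _ _ g]
        simp: measurable_flux_family_def space_restrict_space)
  have *: "(\<integral>\<^sup>+z. g z \<partial>total_variation (j t)) = (\<integral>\<^sup>+z. g z \<partial>fst (j t)) + (\<integral>\<^sup>+z. g z \<partial>snd (j t))"
    if "t \<in> space (restrict_space borel {0..T})" for t
    using that js by (intro nn_integral_total_variation g) (auto simp: space_restrict_space)
  show ?thesis by (rule measurable_cong[THEN iffD2, OF *]) measurable
qed

lemma borel_measurable_flux_integral_family:
  assumes j: "measurable_flux_family T j" and [measurable]: "g \<in> borel_measurable borel" "S \<in> sets borel"
  shows "(\<lambda>t. flux_integral S (j t) g) \<in> borel_measurable (restrict_space borel {0..T})"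
proof -
  have js: "sets (fst (j t)) = sets borel" "sets (snd (j t)) = sets borel" if "t \<in> {0..T}" for t
    using measurable_flux_familyD[OF j that] .
  have g: "(\<lambda>z. indicator S z *\<^sub>R g z) \<in> borel_measurable borel" by measurable
  have [measurable]: "(\<lambda>t. LINT z:S|fst (j t). g z) \<in> borel_measurable (restrict_space borel {0..T})"
    "(\<lambda>t. LINT z:S|snd (j t). g z) \<in> borel_measurable (restrict_space borel {0..T})"
    unfolding set_lebesgue_integral_def using j js
    by (intro borel_measurable_lebesgue_integral_family[OF _ _ g];
        simp add: measurable_flux_family_def space_restrict_space)+
  show ?thesis unfolding flux_integral_def by measurable
qed

text \<open>Nothing says that the dissipation \<open>R\<close> depends measurably on time, so that its integral is only a
  lower integral and not additive; the bound survives because \<open>H - k\<close> is measurable.\<close>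

lemma nn_integral_add_const_le:
  fixes H R :: "real \<Rightarrow> ennreal"
  assumes T: "0 \<le> T" and H: "H \<in> borel_measurable (restrict_space borel {0..T})"
    and le: "AE t in lborel. t \<in> {0..T} \<longrightarrow> H t \<le> R t + k"
  shows "(\<integral>\<^sup>+t\<in>{0..T}. H t \<partial>lborel) \<le> (\<integral>\<^sup>+t\<in>{0..T}. R t \<partial>lborel) + k * ennreal T"
\<comment> \<open>For infinite \<open>k\<close> the right side is infinite unless
  \<open>T = 0\<close>; then infinity times 0 is 0, but the time interval is a null set.\<close>
proof (cases "k = \<infinity>")
  case True
  then show ?thesis
  proof (cases "T = 0")
    case True
    have "(\<integral>\<^sup>+t\<in>{0..T}. H t \<partial>lborel) = (\<integral>\<^sup>+t. 0 \<partial>(lborel :: real measure))"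
      using AE_lborel_singleton[of "0 :: real"] True
      by (intro nn_integral_cong_AE) (auto simp: indicator_def)
    then show ?thesis by simp
  next
    case False
    then show ?thesis using \<open>k = \<infinity>\<close> T by (simp add: ennreal_top_mult)
  qed
next
  case False
  have [measurable]: "(\<lambda>t. H t * indicator {0..T} t) \<in> borel_measurable borel"
    using H by (simp add: borel_measurable_restrict_space_iff_ennreal)
  have "(\<integral>\<^sup>+t\<in>{0..T}. H t \<partial>lborel)
      \<le> (\<integral>\<^sup>+t. (H t * indicator {0..T} t - k) + k * indicator {0..T} t \<partial>lborel)"
  proof (rule nn_integral_mono)
    fix t
    have "x \<le> (x - k) + k" for x :: ennreal
      by (metis add.commute ennreal_minus_le_iff ennreal_top_minus False order_refl infinity_ennreal_def)
    then show "H t * indicator {0..T} t \<le> (H t * indicator {0..T} t - k) + k * indicator {0..T} t"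
      by (auto simp: indicator_def)
  qed
  also have "\<dots> = (\<integral>\<^sup>+t. H t * indicator {0..T} t - k \<partial>lborel) + (\<integral>\<^sup>+t. k * indicator {0..T} t \<partial>lborel)"
    by (rule nn_integral_add) measurable
  also have "(\<integral>\<^sup>+t. k * indicator {0..T} t \<partial>(lborel :: real measure)) = k * ennreal T"
    using T by (subst nn_integral_cmult_indicator) auto
  also have "(\<integral>\<^sup>+t. H t * indicator {0..T} t - k \<partial>lborel) \<le> (\<integral>\<^sup>+t\<in>{0..T}. R t \<partial>lborel)"
    using le
  \<comment> \<open>Subtraction is truncated at 0, so both sides vanish off the interval; on it the
    finite \<open>k\<close> is moved across the inequality.\<close>
  proof (intro nn_integral_mono_AE, eventually_elim)
    fix t assume "t \<in> {0..T} \<longrightarrow> H t \<le> R t + k"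
    then show "H t * indicator {0..T} t - k \<le> R t * indicator {0..T} t"
      using False by (auto simp: indicator_def ennreal_minus_le_iff add.commute)
  qed
  finally show ?thesis by (simp add: add_right_mono)
qed

text \<open>The bound at a fixed time is applied to \<open>s * g\<close> and integrated. The
  dissipation does not pick up the factor \<open>s\<close>, and \<open>c\<close> may depend on
  \<open>s\<close> and \<open>K\<close> but is chosen before \<open>g\<close>: this order allows a
  limit in \<open>g\<close> at fixed \<open>s\<close>, followed by large \<open>s\<close>.\<close>

lemma action_bound:
  fixes \<pi> :: "'a::{metric_space, second_countable_topology} measure"
  assumes T: "0 < T" and J: "jump_setting \<pi> \<kappa>" and \<psi>s: "dual_dissipation_density \<psi>s"
    and \<alpha>: "mobility_density \<alpha>" and j: "measurable_flux_family T j"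
    and bd: "bounded_densities \<pi> T \<rho>" and s: "0 < s"
  shows "\<exists>c. \<forall>g \<in> borel_measurable borel. (AE z in edge_measure \<pi> \<kappa>. \<bar>g z\<bar> \<le> K) \<longrightarrow>
    ennreal s * (\<integral>\<^sup>+t\<in>{0..T}. (\<integral>\<^sup>+z. ennreal \<bar>g z\<bar> \<partial>total_variation (j t)) \<partial>lborel)
    \<le> (\<integral>\<^sup>+t\<in>{0..T}. dissipation_potential \<pi> \<kappa> \<psi>s \<alpha> (\<rho> t) (j t) \<partial>lborel)
      + ennreal c * (\<integral>\<^sup>+z. ennreal ((g z)\<^sup>2) \<partial>edge_measure \<pi> \<kappa>)"
proof -
  obtain C where C: "AE t in lborel. t \<in> {0<..<T} \<longrightarrow> (AE x in \<pi>. measure_density \<pi> (\<rho> t) x \<le> C)"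
    using bd by (auto simp: bounded_densities_def)
  have "bounded ((\<lambda>(p, q). \<alpha> p q) ` ({0..C} \<times> {0..C}))"
    using \<alpha> unfolding mobility_density_def
    by (intro compact_imp_bounded compact_continuous_image compact_Times)
       (auto elim: continuous_on_subset)
  then obtain A where "A > 0" and A': "\<forall>r \<in> (\<lambda>(p, q). \<alpha> p q) ` ({0..C} \<times> {0..C}). norm r \<le> A"
    unfolding bounded_pos by blast
  then have A: "A > 0" "\<And>p q. 0 \<le> p \<Longrightarrow> p \<le> C \<Longrightarrow> 0 \<le> q \<Longrightarrow> q \<le> C \<Longrightarrow> \<alpha> p q \<le> A"
  proof -
    fix p q assume "0 \<le> p" "p \<le> C" "0 \<le> q" "q \<le> C"
    then have "(\<lambda>(p, q). \<alpha> p q) (p, q) \<in> (\<lambda>(p, q). \<alpha> p q) ` ({0..C} \<times> {0..C})" by (intro imageI) auto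
    with A' have "norm (\<alpha> p q) \<le> A" by auto
    then show "\<alpha> p q \<le> A" by simp
  qed
  \<comment> \<open>The range is \<open>s * K\<close> because the quadratic bound will be evaluated
    at \<open>s * g z\<close>.\<close>
  obtain c where c: "c \<ge> 0" "\<And>\<xi>. \<bar>\<xi>\<bar> \<le> s * K \<Longrightarrow> \<psi>s \<xi> \<le> c * \<xi>\<^sup>2"
    by (rule dual_dissipation_density_quadratic_bound[OF \<psi>s, of "s * K"]) (rule that, assumption, simp)
  show ?thesis
  proof (intro exI[of _ "1 / 2 * (A * c * s\<^sup>2) * T"] ballI impI)
    fix g :: "'a \<times> 'a \<Rightarrow> real"
    assume g [measurable]: "g \<in> borel_measurable borel" and K: "AE z in edge_measure \<pi> \<kappa>. \<bar>g z\<bar> \<le> K"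
    define I where "I = (\<integral>\<^sup>+z. ennreal ((g z)\<^sup>2) \<partial>edge_measure \<pi> \<kappa>)"
    define H where "H t = (\<integral>\<^sup>+z. ennreal \<bar>s * g z\<bar> \<partial>total_variation (j t))" for t
    define k where "k = 1 / 2 * (ennreal (A * c) * (\<integral>\<^sup>+z. ennreal ((s * g z)\<^sup>2) \<partial>edge_measure \<pi> \<kappa>))"
    have sK: "AE z in edge_measure \<pi> \<kappa>. \<bar>s * g z\<bar> \<le> s * K"
      using K by eventually_elim (use s in \<open>simp add: abs_mult\<close>)
    have H_eq: "H t = ennreal s * (\<integral>\<^sup>+z. ennreal \<bar>g z\<bar> \<partial>total_variation (j t))" for t
      unfolding H_def using s by (subst nn_integral_cmult[symmetric]) (auto simp: abs_mult ennreal_mult)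
    have [measurable]: "(\<lambda>t. (\<integral>\<^sup>+z. ennreal \<bar>g z\<bar> \<partial>total_variation (j t)) * indicator {0..T} t) \<in> borel_measurable lborel"
      using borel_measurable_total_variation_family[OF j, of "\<lambda>z. ennreal \<bar>g z\<bar>"]
      by (simp add: borel_measurable_restrict_space_iff_ennreal)
    have k_eq: "k = ennreal (1 / 2 * (A * c * s\<^sup>2)) * I"
    proof -
      have "(\<integral>\<^sup>+z. ennreal ((s * g z)\<^sup>2) \<partial>edge_measure \<pi> \<kappa>) = ennreal (s\<^sup>2) * I"
        unfolding I_def by (subst nn_integral_cmult[symmetric]) (auto simp: power_mult_distrib ennreal_mult)
      moreover have "(1 / 2 :: ennreal) = ennreal (1 / 2)"
        by (metis divide_ennreal ennreal_1 ennreal_numeral zero_le_one zero_less_numeral)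
      moreover have "ennreal (1 / 2 * (A * c * s\<^sup>2)) = ennreal (1 / 2) * ennreal (A * c * s\<^sup>2)"
        by (rule ennreal_mult) (use A(1) c(1) in auto)
      moreover have "ennreal (A * c * s\<^sup>2) = ennreal (A * c) * ennreal (s\<^sup>2)"
        by (rule ennreal_mult) (use A(1) c(1) in auto)
      ultimately show ?thesis unfolding k_def by (simp only: mult.assoc)
    qed
    have "(\<integral>\<^sup>+t\<in>{0..T}. H t \<partial>lborel)
        \<le> (\<integral>\<^sup>+t\<in>{0..T}. dissipation_potential \<pi> \<kappa> \<psi>s \<alpha> (\<rho> t) (j t) \<partial>lborel) + k * ennreal T"
    proof (rule nn_integral_add_const_le)
      show "H \<in> borel_measurable (restrict_space borel {0..T})"
        unfolding H_def by (rule borel_measurable_total_variation_family[OF j]) measurable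
      show "AE t in lborel. t \<in> {0..T} \<longrightarrow> H t \<le> dissipation_potential \<pi> \<kappa> \<psi>s \<alpha> (\<rho> t) (j t) + k"
        \<comment> \<open>The density bound concerns the open time interval; its two endpoints form
          a null set.\<close>
        using C AE_lborel_singleton[of 0] AE_lborel_singleton[of T]
      proof eventually_elim
        fix t assume t: "t \<in> {0<..<T} \<longrightarrow> (AE x in \<pi>. measure_density \<pi> (\<rho> t) x \<le> C)" "t \<noteq> 0" "t \<noteq> T"
        show "t \<in> {0..T} \<longrightarrow> H t \<le> dissipation_potential \<pi> \<kappa> \<psi>s \<alpha> (\<rho> t) (j t) + k"
          unfolding H_def k_def
        proof (intro impI nn_integral_total_variation_le_dissipation[OF J \<psi>s \<alpha> _ _ _ A(2) c _ sK])
          assume "t \<in> {0..T}"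
          then show "j t \<in> fluxes" "AE x in \<pi>. measure_density \<pi> (\<rho> t) x \<le> C"
            using j t by (auto simp: measurable_flux_family_def)
        qed (use A in auto)
      qed
    qed (use T in simp)
    moreover have "(\<integral>\<^sup>+t\<in>{0..T}. H t \<partial>lborel)
        = ennreal s * (\<integral>\<^sup>+t\<in>{0..T}. (\<integral>\<^sup>+z. ennreal \<bar>g z\<bar> \<partial>total_variation (j t)) \<partial>lborel)"
      by (simp add: H_eq mult.assoc nn_integral_cmult)
    moreover have "k * ennreal T = ennreal (1 / 2 * (A * c * s\<^sup>2) * T) * I"
    proof -
      have "ennreal (1 / 2 * (A * c * s\<^sup>2) * T) = ennreal (1 / 2 * (A * c * s\<^sup>2)) * ennreal T"
        by (rule ennreal_mult) (use T A(1) c(1) in auto)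
      then show ?thesis unfolding k_eq by (simp only: mult_ac)
    qed
    ultimately show "ennreal s * (\<integral>\<^sup>+t\<in>{0..T}. (\<integral>\<^sup>+z. ennreal \<bar>g z\<bar> \<partial>total_variation (j t)) \<partial>lborel)
      \<le> (\<integral>\<^sup>+t\<in>{0..T}. dissipation_potential \<pi> \<kappa> \<psi>s \<alpha> (\<rho> t) (j t) \<partial>lborel)
        + ennreal (1 / 2 * (A * c * s\<^sup>2) * T) * (\<integral>\<^sup>+z. ennreal ((g z)\<^sup>2) \<partial>edge_measure \<pi> \<kappa>)"
      by (simp add: I_def)
  qed
qed

section \<open>Passing to the limit\<close>

lemma nonlocal_grad_borel_measurable [measurable]:
  fixes f :: "'a::second_countable_topology \<Rightarrow> real"
  assumes f: "f \<in> borel_measurable borel"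
  shows "nonlocal_grad f \<in> borel_measurable borel"
  unfolding nonlocal_grad_def case_prod_beta
  by (intro borel_measurable_diff measurable_compose[OF fst_borel_measurable f]
      measurable_compose[OF snd_borel_measurable f])

lemma indicator_off_diagonal_nonlocal_grad:
  "indicat_real off_diagonal z *\<^sub>R nonlocal_grad f z = nonlocal_grad f z"
  by (cases z) (auto simp: nonlocal_grad_def off_diagonal_def indicator_def)

lemma nn_integral_nonlocal_grad_off_diagonal:
  "(\<integral>\<^sup>+z\<in>off_diagonal. ennreal ((nonlocal_grad f z)\<^sup>2) \<partial>M) = (\<integral>\<^sup>+z. ennreal ((nonlocal_grad f z)\<^sup>2) \<partial>M)"
  by (intro nn_integral_cong) (auto simp: nonlocal_grad_def off_diagonal_def indicator_def)

text \<open>Finiteness of both absolute integrals excludes the default value 0 of the Bochner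
  integral, so linearity holds on each part of the flux. Taking \<open>h = 0\<close> bounds a single
  flux integral.\<close>

lemma flux_integral_diff_le:
  assumes js: "sets (fst j) = sets borel" "sets (snd j) = sets borel" and [measurable]: "S \<in> sets borel"
    and [measurable]: "g \<in> borel_measurable borel" "h \<in> borel_measurable borel"
    and fin: "(\<integral>\<^sup>+z. ennreal \<bar>g z\<bar> \<partial>total_variation j) < \<infinity>" "(\<integral>\<^sup>+z. ennreal \<bar>h z\<bar> \<partial>total_variation j) < \<infinity>"
  shows "ennreal \<bar>flux_integral S j g - flux_integral S j h\<bar>
    \<le> (\<integral>\<^sup>+z. ennreal \<bar>g z - h z\<bar> \<partial>total_variation j)"
proof -
  have i: "integrable (fst j) g" "integrable (snd j) g" "integrable (fst j) h" "integrable (snd j) h"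
    using fin by (auto simp: integrable_iff_bounded nn_integral_total_variation[OF js] js
        cong: measurable_cong_sets)
  have si: "set_integrable M S k" if "sets M = sets borel" "integrable M k" for M and k :: "'a \<Rightarrow> real"
    using that unfolding set_integrable_def by (intro integrable_mult_indicator) auto
  have b: "ennreal \<bar>LINT z:S|M. g z - h z\<bar> \<le> (\<integral>\<^sup>+z. ennreal \<bar>g z - h z\<bar> \<partial>M)"
    if M: "sets M = sets borel" "integrable M g" "integrable M h" for M
  proof -
    have "integrable M (\<lambda>z. indicator S z *\<^sub>R (g z - h z))"
      using si[OF M(1), of "\<lambda>z. g z - h z"] M unfolding set_integrable_def by auto
    then have "ennreal \<bar>LINT z:S|M. g z - h z\<bar> \<le> (\<integral>\<^sup>+z. ennreal (norm (indicator S z *\<^sub>R (g z - h z))) \<partial>M)"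
      unfolding set_lebesgue_integral_def real_norm_def[symmetric] by (rule integral_norm_bound_ennreal)
    also have "\<dots> \<le> (\<integral>\<^sup>+z. ennreal \<bar>g z - h z\<bar> \<partial>M)"
      by (intro nn_integral_mono) (auto simp: indicator_def)
    finally show ?thesis .
  qed
  have "flux_integral S j g - flux_integral S j h = (LINT z:S|fst j. g z - h z) - (LINT z:S|snd j. g z - h z)"
    unfolding flux_integral_def using i js by (simp add: set_integral_diff si)
  then have "ennreal \<bar>flux_integral S j g - flux_integral S j h\<bar>
      \<le> ennreal (\<bar>LINT z:S|fst j. g z - h z\<bar> + \<bar>LINT z:S|snd j. g z - h z\<bar>)"
    by (intro ennreal_leI) linarith
  also have "\<dots> \<le> (\<integral>\<^sup>+z. ennreal \<bar>g z - h z\<bar> \<partial>total_variation j)"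
    using add_mono[OF b[OF js(1) i(1,3)] b[OF js(2) i(2,4)]]
    by (simp add: nn_integral_total_variation[OF js])
  finally show ?thesis .
qed

text \<open>The flux integrals converge in \<open>L\<^sup>1\<close> over the whole time interval,
  hence over every subinterval, while the mass terms converge at each time. The bound
  \<open>fin\<close> supplies the integrability clauses for \<open>f\<close>.\<close>

lemma tested_continuity_equation_limit:
  fixes f :: "'a::{metric_space, second_countable_topology} \<Rightarrow> real"
  assumes j: "measurable_flux_family T j"
    and f [measurable]: "f \<in> borel_measurable borel" and G [measurable]: "\<And>n. G n \<in> borel_measurable borel"
    and int: "\<And>t. t \<in> {0..T} \<Longrightarrow> integrable (\<rho> t) f"
    and conv: "\<And>t. t \<in> {0..T} \<Longrightarrow> (\<lambda>n. LINT x|\<rho> t. G n x) \<longlonglongrightarrow> (LINT x|\<rho> t. f x)"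
    and tested: "\<And>n :: nat. tested_continuity_equation T \<rho> j (G n)"
    and fin: "(\<integral>\<^sup>+t\<in>{0..T}. (\<integral>\<^sup>+z. ennreal \<bar>nonlocal_grad f z\<bar> \<partial>total_variation (j t)) \<partial>lborel) < \<infinity>"
    and lim: "(\<lambda>n. \<integral>\<^sup>+t\<in>{0..T}. (\<integral>\<^sup>+z. ennreal \<bar>nonlocal_grad (G n) z - nonlocal_grad f z\<bar>
        \<partial>total_variation (j t)) \<partial>lborel) \<longlonglongrightarrow> 0"
  shows "tested_continuity_equation T \<rho> j f"
proof -
  note js = measurable_flux_familyD[OF j]
  have [measurable]: "{0..T} \<in> sets lborel" by simp
  define H where "H t = (\<integral>\<^sup>+z. ennreal \<bar>nonlocal_grad f z\<bar> \<partial>total_variation (j t))" for t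
  define \<Phi> where "\<Phi> g t = flux_integral off_diagonal (j t) (nonlocal_grad g)" for g t
  have [measurable]: "(\<lambda>t. H t * indicator {0..T} t) \<in> borel_measurable lborel"
    using borel_measurable_total_variation_family[OF j, of "\<lambda>z. ennreal \<bar>nonlocal_grad f z\<bar>"]
    by (simp add: borel_measurable_restrict_space_iff_ennreal H_def)
  have "AE t in lborel. H t * indicator {0..T} t \<noteq> \<infinity>"
    using fin by (intro nn_integral_PInf_AE) (measurable, simp add: H_def)
  then have Hfin: "AE t in lborel. t \<in> {0..T} \<longrightarrow> H t < \<infinity>"
    by eventually_elim (auto simp: top.not_eq_extremum)
  have tv_int: "set_integrable (total_variation (j t)) off_diagonal (nonlocal_grad g)
      \<longleftrightarrow> (\<integral>\<^sup>+z. ennreal \<bar>nonlocal_grad g z\<bar> \<partial>total_variation (j t)) < \<infinity>"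
    if [measurable]: "g \<in> borel_measurable borel" for g t
    unfolding set_integrable_def indicator_off_diagonal_nonlocal_grad by (simp add: integrable_iff_bounded)
  have \<Phi>_measurable: "set_borel_measurable lborel {0..T} (\<Phi> g)" if [measurable]: "g \<in> borel_measurable borel" for g
    using borel_measurable_flux_integral_family[OF j, of "nonlocal_grad g" off_diagonal]
    by (simp add: set_borel_measurable_def \<Phi>_def borel_measurable_restrict_space_iff mult.commute)
  have \<Phi>_int: "set_integrable lborel {0..T} (\<Phi> f)"
    unfolding set_integrable_def
  proof (rule integrableI_bounded)
    show "(\<lambda>t. indicator {0..T} t *\<^sub>R \<Phi> f t) \<in> borel_measurable lborel"
      using \<Phi>_measurable[OF f] by (simp add: set_borel_measurable_def)
    have "(\<integral>\<^sup>+t. ennreal (norm (indicator {0..T} t *\<^sub>R \<Phi> f t)) \<partial>lborel) \<le> (\<integral>\<^sup>+t\<in>{0..T}. H t \<partial>lborel)"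
      using Hfin
    proof (intro nn_integral_mono_AE, eventually_elim)
      fix t assume t: "t \<in> {0..T} \<longrightarrow> H t < \<infinity>"
      show "ennreal (norm (indicator {0..T} t *\<^sub>R \<Phi> f t)) \<le> H t * indicator {0..T} t"
        \<comment> \<open>Comparison with the zero function bounds the flux integral itself.\<close>
        using flux_integral_diff_le[OF js, of t off_diagonal "nonlocal_grad f" "\<lambda>_. 0"] t
        by (auto simp: indicator_def \<Phi>_def H_def flux_integral_def)
    qed
    also have "\<dots> < \<infinity>" using fin by (simp add: H_def)
    finally show "(\<integral>\<^sup>+t. ennreal (norm (indicator {0..T} t *\<^sub>R \<Phi> f t)) \<partial>lborel) < \<infinity>" .
  qed
  have eq: "(LINT x|\<rho> t. f x) - (LINT x|\<rho> s. f x) = (LINT r:{s..t}|lborel. \<Phi> f r)"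
    if st: "0 \<le> s" "s \<le> t" "t \<le> T" for s t
  proof (rule LIMSEQ_unique)
    have sub: "{s..t} \<subseteq> {0..T}" using st by auto
    show "(\<lambda>n. (LINT x|\<rho> t. G n x) - (LINT x|\<rho> s. G n x)) \<longlonglongrightarrow> (LINT x|\<rho> t. f x) - (LINT x|\<rho> s. f x)"
      using st by (intro tendsto_diff conv) auto
    have Gint: "set_integrable lborel {0..T} (\<Phi> (G n))" for n
      using tested[of n] by (simp add: tested_continuity_equation_def \<Phi>_def[abs_def])
    have "(\<lambda>n. LINT r:{s..t}|lborel. \<Phi> (G n) r) \<longlonglongrightarrow> (LINT r:{s..t}|lborel. \<Phi> f r)"
      unfolding set_lebesgue_integral_def
    proof (rule tendsto_L1_int)
      show "integrable lborel (\<lambda>r. indicator {s..t} r *\<^sub>R \<Phi> (G n) r)" for n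
        using set_integrable_subset[OF Gint _ sub] by (simp add: set_integrable_def)
      show "integrable lborel (\<lambda>r. indicator {s..t} r *\<^sub>R \<Phi> f r)"
        using set_integrable_subset[OF \<Phi>_int _ sub] by (simp add: set_integrable_def)
      have le: "(\<integral>\<^sup>+r. ennreal (norm (indicator {s..t} r *\<^sub>R \<Phi> (G n) r - indicator {s..t} r *\<^sub>R \<Phi> f r)) \<partial>lborel)
        \<le> (\<integral>\<^sup>+t\<in>{0..T}. (\<integral>\<^sup>+z. ennreal \<bar>nonlocal_grad (G n) z - nonlocal_grad f z\<bar>
          \<partial>total_variation (j t)) \<partial>lborel)" for n
      proof -
        \<comment> \<open>The tested equation includes the integrability of the gradient of
          \<open>G n\<close>, which justifies subtracting the flux integrals at almost every
          time.\<close>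
        have "AE r in lborel. r \<in> {0..T} \<longrightarrow> (\<integral>\<^sup>+z. ennreal \<bar>nonlocal_grad (G n) z\<bar> \<partial>total_variation (j r)) < \<infinity>"
          using tested[of n] unfolding tested_continuity_equation_def by (simp add: tv_int)
        with Hfin show ?thesis
        proof (intro nn_integral_mono_AE, eventually_elim)
          fix r
          assume r: "r \<in> {0..T} \<longrightarrow> H r < \<infinity>"
            "r \<in> {0..T} \<longrightarrow> (\<integral>\<^sup>+z. ennreal \<bar>nonlocal_grad (G n) z\<bar> \<partial>total_variation (j r)) < \<infinity>"
          show "ennreal (norm (indicator {s..t} r *\<^sub>R \<Phi> (G n) r - indicator {s..t} r *\<^sub>R \<Phi> f r))
            \<le> (\<integral>\<^sup>+z. ennreal \<bar>nonlocal_grad (G n) z - nonlocal_grad f z\<bar> \<partial>total_variation (j r)) * indicator {0..T} r"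
          proof (cases "r \<in> {s..t}")
            case True
            then have "r \<in> {0..T}" using sub by auto
            then show ?thesis
              using flux_integral_diff_le[OF js, of r off_diagonal "nonlocal_grad (G n)" "nonlocal_grad f"] r True
              by (simp add: \<Phi>_def H_def)
          qed simp
        qed
      qed
      show "(\<lambda>n. \<integral>\<^sup>+r. ennreal (norm (indicator {s..t} r *\<^sub>R \<Phi> (G n) r - indicator {s..t} r *\<^sub>R \<Phi> f r)) \<partial>lborel)
          \<longlonglongrightarrow> 0"
        by (rule tendsto_sandwich[OF _ _ tendsto_const lim]) (use le in \<open>auto simp del: real_scaleR_def\<close>)
    qed
    then show "(\<lambda>n. (LINT x|\<rho> t. G n x) - (LINT x|\<rho> s. G n x)) \<longlonglongrightarrow> (LINT r:{s..t}|lborel. \<Phi> f r)"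
      using tested st by (simp add: tested_continuity_equation_def \<Phi>_def[abs_def] del: atLeastAtMost_iff)
  qed
  show ?thesis
    unfolding tested_continuity_equation_def
    using int Hfin \<Phi>_int eq by (simp add: tv_int H_def \<Phi>_def[abs_def])
qed

section \<open>Truncation, the scaling argument and the approximating sequence\<close>

definition clip :: "real \<Rightarrow> real \<Rightarrow> real" where
  "clip C x = max (- C) (min C x)"

lemma abs_clip_le: "0 \<le> C \<Longrightarrow> \<bar>clip C x\<bar> \<le> C"
  by (auto simp: clip_def max_def min_def abs_if)

lemma clip_nonexpansive: "\<bar>clip C x - clip C y\<bar> \<le> \<bar>x - y\<bar>"
  by (auto simp: clip_def max_def min_def abs_if)

lemma clip_eq: "\<bar>x\<bar> \<le> C \<Longrightarrow> clip C x = x"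
  by (auto simp: clip_def)

lemma continuous_on_clip: "continuous_on A (clip C)"
  unfolding clip_def by (intro continuous_intros)

lemma clip_tendsto:
  assumes "(X \<longlongrightarrow> y) A" "\<bar>y\<bar> \<le> C"
  shows "((\<lambda>n. clip C (X n)) \<longlongrightarrow> y) A"
proof -
  have "((\<lambda>n. clip C (X n)) \<longlongrightarrow> clip C y) A"
    unfolding clip_def by (intro tendsto_intros assms)
  then show ?thesis using assms(2) by (simp add: clip_eq)
qed

text \<open>Clipping is nonexpansive, so the Lipschitz constant survives; the continuity equation
  therefore remains available for clipped test functions.\<close>

lemma Lip_b_clip:
  assumes "F \<in> Lip_b" "0 \<le> C"
  shows "(\<lambda>x. clip C (F x)) \<in> Lip_b"
proof -
  obtain L where L: "L-lipschitz_on UNIV F" using assms by (auto simp: Lip_b_def)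
  have "L-lipschitz_on UNIV (\<lambda>x. clip C (F x))"
  proof (rule lipschitz_onI)
    fix x y
    have "dist (clip C (F x)) (clip C (F y)) \<le> dist (F x) (F y)"
      by (simp add: dist_real_def clip_nonexpansive)
    also have "\<dots> \<le> L * dist x y" by (rule lipschitz_onD[OF L]) auto
    finally show "dist (clip C (F x)) (clip C (F y)) \<le> L * dist x y" .
  qed (rule lipschitz_on_nonneg[OF L])
  moreover have "bounded (range (\<lambda>x. clip C (F x)))"
    using abs_clip_le[OF assms(2)] by (auto simp: bounded_iff)
  ultimately show ?thesis by (auto simp: Lip_b_def)
qed

text \<open>Clipping is not continuous for the seminorm \<open>\<parallel>\<nabla>\<cdot>\<parallel>\<^sub>2\<close> by its contraction property alone: for
  \<open>e = \<nabla>F\<^sub>n - \<nabla>f\<close> and \<open>d = \<nabla>G\<^sub>n - \<nabla>f\<close> one has \<open>\<bar>d\<bar> \<le> \<bar>e\<bar> + min \<bar>d\<bar> (2 \<bar>\<nabla>f\<bar>)\<close>, and the last term tends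
  to 0 by dominated convergence.\<close>

lemma nonlocal_grad_clip_tendsto:
  fixes \<pi> :: "'a::{metric_space, second_countable_topology} measure"
  assumes J: "jump_setting \<pi> \<kappa>" and [measurable]: "f \<in> borel_measurable borel" "\<And>n. F n \<in> borel_measurable borel"
    and C: "AE x in \<pi>. \<bar>f x\<bar> \<le> C"
    and fin: "(\<integral>\<^sup>+z. ennreal ((nonlocal_grad f z)\<^sup>2) \<partial>edge_measure \<pi> \<kappa>) < \<infinity>"
    and pt: "AE x in \<pi>. (\<lambda>n. F n x) \<longlonglongrightarrow> f x"
    and lim: "(\<lambda>n :: nat. \<integral>\<^sup>+z. ennreal ((nonlocal_grad (F n) z - nonlocal_grad f z)\<^sup>2) \<partial>edge_measure \<pi> \<kappa>) \<longlonglongrightarrow> 0"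
  shows "(\<lambda>n. \<integral>\<^sup>+z. ennreal ((nonlocal_grad (\<lambda>x. clip C (F n x)) z - nonlocal_grad f z)\<^sup>2) \<partial>edge_measure \<pi> \<kappa>) \<longlonglongrightarrow> 0"
proof -
  have \<pi>: "sets \<pi> = sets borel" and sw: "distr (edge_measure \<pi> \<kappa>) borel prod.swap = edge_measure \<pi> \<kappa>"
    using J by (auto simp: jump_setting_def finite_borel_measures_def)
  have [measurable]: "clip C \<in> borel_measurable borel"
    by (intro borel_measurable_continuous_onI continuous_on_clip)
  define N where "N = nonlocal_grad f"
  define e where "e n z = nonlocal_grad (F n) z - N z" for n z
  define d where "d n z = nonlocal_grad (\<lambda>x. clip C (F n x)) z - N z" for n z
  define m where "m n z = min \<bar>d n z\<bar> (2 * \<bar>N z\<bar>)" for n z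
  have [measurable]: "N \<in> borel_measurable borel" "\<And>n. e n \<in> borel_measurable borel"
    "\<And>n. d n \<in> borel_measurable borel" "\<And>n. m n \<in> borel_measurable borel"
    unfolding N_def e_def d_def m_def by measurable
  have P: "AE x in \<pi>. (\<lambda>n. clip C (F n x)) \<longlonglongrightarrow> f x"
    using C pt by eventually_elim (rule clip_tendsto)
  have d0: "AE z in edge_measure \<pi> \<kappa>. (\<lambda>n. d n z) \<longlonglongrightarrow> 0"
    using AE_edge_measure_fst[OF \<pi> P, of \<kappa>] AE_edge_measure_snd[OF \<pi> sw P]
  proof eventually_elim
    fix z assume "(\<lambda>n. clip C (F n (fst z))) \<longlonglongrightarrow> f (fst z)" "(\<lambda>n. clip C (F n (snd z))) \<longlonglongrightarrow> f (snd z)"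
    from tendsto_diff[OF this(2,1)] show "(\<lambda>n. d n z) \<longlonglongrightarrow> 0"
      unfolding d_def N_def nonlocal_grad_def case_prod_beta by (rule LIM_zero)
  qed
  have "(\<lambda>n. \<integral>\<^sup>+z. ennreal ((m n z)\<^sup>2) \<partial>edge_measure \<pi> \<kappa>) \<longlonglongrightarrow> (\<integral>\<^sup>+z. 0 \<partial>edge_measure \<pi> \<kappa>)"
  proof (rule nn_integral_dominated_convergence[where w = "\<lambda>z. ennreal (4 * (N z)\<^sup>2)"])
    have "(m n z)\<^sup>2 \<le> (2 * \<bar>N z\<bar>)\<^sup>2" for n z by (intro power_mono) (auto simp: m_def)
    then show "AE z in edge_measure \<pi> \<kappa>. ennreal ((m n z)\<^sup>2) \<le> ennreal (4 * (N z)\<^sup>2)" for n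
      by (intro AE_I2 ennreal_leI) (simp add: power_mult_distrib)
    have "(\<integral>\<^sup>+z. ennreal (4 * (N z)\<^sup>2) \<partial>edge_measure \<pi> \<kappa>) = 4 * (\<integral>\<^sup>+z. ennreal ((N z)\<^sup>2) \<partial>edge_measure \<pi> \<kappa>)"
      by (subst nn_integral_cmult[symmetric]) (auto simp: ennreal_mult)
    then show "(\<integral>\<^sup>+z. ennreal (4 * (N z)\<^sup>2) \<partial>edge_measure \<pi> \<kappa>) < \<infinity>"
      using fin by (simp add: N_def ennreal_mult_less_top)
    show "AE z in edge_measure \<pi> \<kappa>. (\<lambda>n. ennreal ((m n z)\<^sup>2)) \<longlonglongrightarrow> 0"
      using d0
    proof eventually_elim
      fix z assume "(\<lambda>n. d n z) \<longlonglongrightarrow> 0"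
      then have "(\<lambda>n. ennreal ((min \<bar>d n z\<bar> (2 * \<bar>N z\<bar>))\<^sup>2)) \<longlonglongrightarrow> ennreal ((min \<bar>0\<bar> (2 * \<bar>N z\<bar>))\<^sup>2)"
        by (intro tendsto_intros)
      then show "(\<lambda>n. ennreal ((m n z)\<^sup>2)) \<longlonglongrightarrow> 0" by (simp add: m_def)
    qed
  qed measurable
  then have m0: "(\<lambda>n. \<integral>\<^sup>+z. ennreal ((m n z)\<^sup>2) \<partial>edge_measure \<pi> \<kappa>) \<longlonglongrightarrow> 0" by simp
  have pw: "(d n z)\<^sup>2 \<le> 2 * (e n z)\<^sup>2 + 2 * (m n z)\<^sup>2" for n z
  proof -
    have "\<bar>nonlocal_grad (\<lambda>x. clip C (F n x)) z\<bar> \<le> \<bar>nonlocal_grad (F n) z\<bar>"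
      by (simp add: nonlocal_grad_def case_prod_beta clip_nonexpansive)
    \<comment> \<open>Either \<open>m n z\<close> equals \<open>\<bar>d n z\<bar>\<close>, or it
      equals \<open>2 * \<bar>N z\<bar>\<close>. In the second case contraction gives \<open>\<bar>d
      n z\<bar> \<le> \<bar>nonlocal_grad (F n) z\<bar> + \<bar>N z\<bar>\<close>, and the gradient
      is at most \<open>\<bar>e n z\<bar> + \<bar>N z\<bar>\<close>.\<close>
    then have "\<bar>d n z\<bar> \<le> \<bar>e n z\<bar> + m n z" unfolding d_def e_def m_def by linarith
    then have "\<bar>d n z\<bar>\<^sup>2 \<le> (\<bar>e n z\<bar> + m n z)\<^sup>2" by (intro power_mono) auto
    also have "\<dots> \<le> 2 * \<bar>e n z\<bar>\<^sup>2 + 2 * (m n z)\<^sup>2"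
      using zero_le_power2[of "\<bar>e n z\<bar> - m n z"] by (simp only: power2_sum power2_diff)
    finally show ?thesis by simp
  qed
  have le: "(\<integral>\<^sup>+z. ennreal ((d n z)\<^sup>2) \<partial>edge_measure \<pi> \<kappa>)
      \<le> 2 * (\<integral>\<^sup>+z. ennreal ((e n z)\<^sup>2) \<partial>edge_measure \<pi> \<kappa>) + 2 * (\<integral>\<^sup>+z. ennreal ((m n z)\<^sup>2) \<partial>edge_measure \<pi> \<kappa>)" for n
  proof -
    have "(\<integral>\<^sup>+z. ennreal ((d n z)\<^sup>2) \<partial>edge_measure \<pi> \<kappa>)
        \<le> (\<integral>\<^sup>+z. 2 * ennreal ((e n z)\<^sup>2) + 2 * ennreal ((m n z)\<^sup>2) \<partial>edge_measure \<pi> \<kappa>)"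
    proof (rule nn_integral_mono)
      fix z
      have "ennreal ((d n z)\<^sup>2) \<le> ennreal (2 * (e n z)\<^sup>2 + 2 * (m n z)\<^sup>2)" by (rule ennreal_leI[OF pw])
      then show "ennreal ((d n z)\<^sup>2) \<le> 2 * ennreal ((e n z)\<^sup>2) + 2 * ennreal ((m n z)\<^sup>2)"
        by (simp add: ennreal_mult)
    qed
    also have "\<dots> = 2 * (\<integral>\<^sup>+z. ennreal ((e n z)\<^sup>2) \<partial>edge_measure \<pi> \<kappa>) + 2 * (\<integral>\<^sup>+z. ennreal ((m n z)\<^sup>2) \<partial>edge_measure \<pi> \<kappa>)"
      by (simp add: nn_integral_add nn_integral_cmult)
    finally show ?thesis .
  qed
  have "(\<lambda>n. 2 * (\<integral>\<^sup>+z. ennreal ((e n z)\<^sup>2) \<partial>edge_measure \<pi> \<kappa>) + 2 * (\<integral>\<^sup>+z. ennreal ((m n z)\<^sup>2) \<partial>edge_measure \<pi> \<kappa>))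
      \<longlonglongrightarrow> 2 * 0 + 2 * 0"
    using lim m0 by (intro tendsto_add ennreal_tendsto_cmult) (simp_all add: e_def N_def)
  then have up: "(\<lambda>n. 2 * (\<integral>\<^sup>+z. ennreal ((e n z)\<^sup>2) \<partial>edge_measure \<pi> \<kappa>) + 2 * (\<integral>\<^sup>+z. ennreal ((m n z)\<^sup>2) \<partial>edge_measure \<pi> \<kappa>))
      \<longlonglongrightarrow> 0" by simp
  have "(\<lambda>n. \<integral>\<^sup>+z. ennreal ((d n z)\<^sup>2) \<partial>edge_measure \<pi> \<kappa>) \<longlonglongrightarrow> 0"
    by (rule tendsto_sandwich[OF _ _ tendsto_const up]) (simp_all add: le)
  then show ?thesis by (simp add: d_def N_def)
qed

text \<open>The two limits are taken in order: \<open>s\<close> is fixed so large that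
  \<open>M / s\<close> lies below the target, and only then does \<open>n\<close> grow to absorb the
  error, whose factor depends on \<open>s\<close>.\<close>

lemma tendsto_0_ennreal_scaling:
  fixes X E :: "nat \<Rightarrow> ennreal"
  assumes M: "M < \<infinity>" and E: "E \<longlonglongrightarrow> 0"
    and le: "\<And>s. 0 < s \<Longrightarrow> \<exists>c. \<forall>n. ennreal s * X n \<le> M + ennreal c * E n"
  shows "X \<longlonglongrightarrow> 0"
proof (rule tendsto_zero_ennreal)
  fix r :: real assume r: "0 < r"
  define m where "m = enn2real M"
  have m: "0 \<le> m" "M = ennreal m" using M by (auto simp: m_def)
  \<comment> \<open>With this choice, \<open>X n \<ge> r\<close> would give
    \<open>m + 2 = s * r \<le> s * X n \<le> m + 1\<close> once the error is below 1.\<close>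
  define s where "s = (m + 2) / r"
  have s: "0 < s" "s * r = m + 2" using r m by (auto simp: s_def)
  obtain c where c: "\<And>n. ennreal s * X n \<le> M + ennreal c * E n" using le[OF s(1)] by blast
  have "(\<lambda>n. ennreal c * E n) \<longlonglongrightarrow> ennreal c * 0" by (intro ennreal_tendsto_cmult E) auto
  then have "\<forall>\<^sub>F n in sequentially. ennreal c * E n < 1" by (intro order_tendstoD(2)) auto
  then show "\<forall>\<^sub>F n in sequentially. X n < ennreal r"
  proof eventually_elim
    fix n assume n: "ennreal c * E n < 1"
    show "X n < ennreal r"
    proof (rule ccontr)
      assume "\<not> X n < ennreal r"
      then have "ennreal s * ennreal r \<le> ennreal s * X n" by (intro mult_left_mono) auto
      also have "\<dots> \<le> ennreal m + 1" using c[of n] n m(2) by (metis add_left_mono order.strict_implies_order order_trans)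
      finally have "ennreal (m + 2) \<le> ennreal (m + 1)"
        using s r m by (simp flip: ennreal_mult)
      then show False using m by simp
    qed
  qed
qed

lemma Lip_b_borel_measurable: "f \<in> Lip_b \<Longrightarrow> f \<in> borel_measurable borel"
  unfolding Lip_b_def using lipschitz_on_continuous_on borel_measurable_continuous_onI by blast

text \<open>Convergence in \<open>L\<^sup>1\<close> yields almost everywhere convergence along a
  subsequence only, so a subsequence is taken before clipping at the essential bound of
  \<open>f\<close>.\<close>

lemma X2_clipped_approximation:
  fixes \<pi> :: "'a::{metric_space, second_countable_topology} measure"
  assumes J: "jump_setting \<pi> \<kappa>" and dense: "Lip_b_dense_in_X2 \<pi> \<kappa>" and f: "f \<in> X2 \<pi> \<kappa>"
  obtains C G where "C \<ge> 0" "AE x in \<pi>. \<bar>f x\<bar> \<le> C" "\<And>n. G n \<in> Lip_b" "\<And>n x. \<bar>G n x\<bar> \<le> C"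
    "AE x in \<pi>. (\<lambda>n :: nat. G n x) \<longlonglongrightarrow> f x"
    "(\<lambda>n. \<integral>\<^sup>+z. ennreal ((nonlocal_grad (G n) z - nonlocal_grad f z)\<^sup>2) \<partial>edge_measure \<pi> \<kappa>) \<longlonglongrightarrow> 0"
proof -
  have \<pi> [measurable_cong]: "sets \<pi> = sets borel" and fin\<pi>: "finite_measure \<pi>"
    using J by (auto simp: jump_setting_def finite_borel_measures_def)
  interpret finite_measure \<pi> by (rule fin\<pi>)
  have f_meas [measurable]: "f \<in> borel_measurable borel" using f by (simp add: X2_def)
  obtain C' where "AE x in \<pi>. \<bar>f x\<bar> \<le> C'" using f by (auto simp: X2_def)
  \<comment> \<open>If \<open>\<pi>\<close> is the null measure, \<open>C'\<close> may be negative;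
    the clipping height must be nonnegative.\<close>
  define C where "C = max C' 0"
  have C: "C \<ge> 0" "AE x in \<pi>. \<bar>f x\<bar> \<le> C"
    using \<open>AE x in \<pi>. \<bar>f x\<bar> \<le> C'\<close> by (auto simp: C_def)
  have fin: "(\<integral>\<^sup>+z. ennreal ((nonlocal_grad f z)\<^sup>2) \<partial>edge_measure \<pi> \<kappa>) < \<infinity>"
    using f by (simp add: X2_def nn_integral_nonlocal_grad_off_diagonal)
  obtain F :: "nat \<Rightarrow> 'a \<Rightarrow> real" where F: "\<And>n. F n \<in> Lip_b"
    and L1: "(\<lambda>n. \<integral>\<^sup>+x. ennreal \<bar>F n x - f x\<bar> \<partial>\<pi>) \<longlonglongrightarrow> 0"
    and L2: "(\<lambda>n. \<integral>\<^sup>+z. ennreal ((nonlocal_grad (F n) z - nonlocal_grad f z)\<^sup>2) \<partial>edge_measure \<pi> \<kappa>) \<longlonglongrightarrow> 0"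
    using dense f unfolding Lip_b_dense_in_X2_def by blast
  have [measurable]: "F n \<in> borel_measurable borel" for n by (rule Lip_b_borel_measurable[OF F])
  have int: "integrable \<pi> (\<lambda>x. F n x - f x)" for n
  proof (rule Bochner_Integration.integrable_diff)
    obtain B where "\<And>x. \<bar>F n x\<bar> \<le> B" using F[of n] by (auto simp: Lip_b_def bounded_iff)
    then show "integrable \<pi> (F n)" by (intro integrable_const_bound[where B = B]) auto
    show "integrable \<pi> f" using C by (intro integrable_const_bound[where B = C]) auto
  qed
  have "(\<lambda>n. \<integral>x. norm (F n x - f x) \<partial>\<pi>) \<longlonglongrightarrow> 0"
  proof -
    have "(\<integral>\<^sup>+x. ennreal \<bar>F n x - f x\<bar> \<partial>\<pi>) = ennreal (\<integral>x. norm (F n x - f x) \<partial>\<pi>)" for n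
      using nn_integral_eq_integral[of \<pi> "\<lambda>x. norm (F n x - f x)"] int by simp
    then show ?thesis using L1 by (simp add: ennreal_tendsto_0_iff)
  qed
  from tendsto_L1_AE_subseq[OF int this]
  obtain r :: "nat \<Rightarrow> nat" where r: "strict_mono r" and "AE x in \<pi>. (\<lambda>n. F (r n) x - f x) \<longlonglongrightarrow> 0" by auto
  then have pt: "AE x in \<pi>. (\<lambda>n. F (r n) x) \<longlonglongrightarrow> f x" by (simp add: LIM_zero_iff)
  define G where "G n x = clip C (F (r n) x)" for n x
  show thesis
  proof (rule that[OF C])
    show "G n \<in> Lip_b" for n unfolding G_def by (rule Lip_b_clip[OF F C(1)])
    show "\<bar>G n x\<bar> \<le> C" for n x unfolding G_def by (rule abs_clip_le[OF C(1)])
    show "AE x in \<pi>. (\<lambda>n. G n x) \<longlonglongrightarrow> f x"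
      unfolding G_def using C(2) pt by eventually_elim (rule clip_tendsto)
    show "(\<lambda>n. \<integral>\<^sup>+z. ennreal ((nonlocal_grad (G n) z - nonlocal_grad f z)\<^sup>2) \<partial>edge_measure \<pi> \<kappa>) \<longlonglongrightarrow> 0"
      unfolding G_def
      using LIMSEQ_subseq_LIMSEQ[OF L2 r]
      by (intro nonlocal_grad_clip_tendsto[OF J _ _ C(2) fin pt]) (simp_all add: o_def)
  qed
qed

section \<open>The continuity equation for all test functions in \<open>X2\<close>\<close>

theorem theorem4p13:
  fixes \<pi> :: "'a::{metric_space, second_countable_topology} measure"
    and \<kappa> :: "'a \<Rightarrow> 'a measure"
    and \<phi> \<psi>s :: "real \<Rightarrow> real"
    and \<alpha> :: "real \<Rightarrow> real \<Rightarrow> real"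
    and T :: real
    and \<rho> :: "real \<Rightarrow> 'a measure"
    and j :: "real \<Rightarrow> ('a \<times> 'a) flux"
  assumes "T > 0"
    and "jump_setting \<pi> \<kappa>"
    and "entropy_density \<phi>"
    and "dual_dissipation_density \<psi>s"
    and "mobility_density \<alpha>"
    and "fisher_information_lsc \<pi> \<kappa> \<phi> \<psi>s \<alpha>"
    and "Lip_b_dense_in_X2 \<pi> \<kappa>"
    and "(\<rho>, j) \<in> ACE \<pi> \<kappa> \<phi> \<psi>s \<alpha> T"
    and "bounded_densities \<pi> T \<rho>"
  shows "(\<rho>, j) \<in> RCE \<pi> \<kappa> \<phi> \<psi>s \<alpha> T"
proof -
  note T = assms(1) and J = assms(2) and bd = assms(9)
  have \<pi> [measurable_cong]: "sets \<pi> = sets borel"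
    and sw: "distr (edge_measure \<pi> \<kappa>) borel prod.swap = edge_measure \<pi> \<kappa>"
    using J by (auto simp: jump_setting_def finite_borel_measures_def)
  have j: "measurable_flux_family T j" and CE: "\<And>f. f \<in> Lip_b \<Longrightarrow> tested_continuity_equation T \<rho> j f"
    and \<rho>: "\<And>t. t \<in> {0..T} \<Longrightarrow> sets (\<rho> t) = sets borel" "\<And>t. t \<in> {0..T} \<Longrightarrow> finite_measure (\<rho> t)"
    and ent: "(SUP t\<in>{0..T}. entropy \<pi> \<phi> (\<rho> t)) < \<infinity>"
    and act: "(\<integral>\<^sup>+t\<in>{0..T}. (dissipation_potential \<pi> \<kappa> \<psi>s \<alpha> (\<rho> t) (j t)
                     + fisher_information \<pi> \<kappa> \<phi> \<psi>s \<alpha> (\<rho> t)) \<partial>lborel) < \<infinity>"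
    using assms(8) unfolding ACE_def CE_def finite_borel_measures_def by auto
  define M where "M = (\<integral>\<^sup>+t\<in>{0..T}. dissipation_potential \<pi> \<kappa> \<psi>s \<alpha> (\<rho> t) (j t) \<partial>lborel)"
  have M: "M < \<infinity>"
    \<comment> \<open>Dropping the Fisher information takes only monotonicity, which holds even for
      nonmeasurable integrands.\<close>
    unfolding M_def by (rule le_less_trans[OF nn_integral_mono act]) (simp add: mult_right_mono)
  \<comment> \<open>The supremum of the entropy runs over all times, and entropy is infinite without
    absolute continuity; hence this holds at every time, endpoints included.\<close>
  have ac: "absolutely_continuous \<pi> (\<rho> t)" if "t \<in> {0..T}" for t
    using le_less_trans[OF SUP_upper[OF that, of "\<lambda>t. entropy \<pi> \<phi> (\<rho> t)"] ent]
    unfolding entropy_def by (auto split: if_splits)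
  have "tested_continuity_equation T \<rho> j f" if f: "f \<in> X2 \<pi> \<kappa>" for f
  proof -
    have f_meas [measurable]: "f \<in> borel_measurable borel" using f by (simp add: X2_def)
    obtain C G where C: "C \<ge> 0" "AE x in \<pi>. \<bar>f x\<bar> \<le> C" and G: "\<And>n. G n \<in> Lip_b" "\<And>n x. \<bar>G n x\<bar> \<le> C"
      and pt: "AE x in \<pi>. (\<lambda>n :: nat. G n x) \<longlonglongrightarrow> f x"
      and L2: "(\<lambda>n. \<integral>\<^sup>+z. ennreal ((nonlocal_grad (G n) z - nonlocal_grad f z)\<^sup>2) \<partial>edge_measure \<pi> \<kappa>) \<longlonglongrightarrow> 0"
      using X2_clipped_approximation[OF J assms(7) f] by blast
    have [measurable]: "G n \<in> borel_measurable borel" for n by (rule Lip_b_borel_measurable[OF G(1)])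
    define X where "X g = (\<integral>\<^sup>+t\<in>{0..T}. (\<integral>\<^sup>+z. ennreal \<bar>g z\<bar> \<partial>total_variation (j t)) \<partial>lborel)" for g :: "'a \<times> 'a \<Rightarrow> real"
    define I where "I g = (\<integral>\<^sup>+z. ennreal ((g z)\<^sup>2) \<partial>edge_measure \<pi> \<kappa>)" for g :: "'a \<times> 'a \<Rightarrow> real"
    have bound: "\<exists>c. \<forall>g \<in> borel_measurable borel. (AE z in edge_measure \<pi> \<kappa>. \<bar>g z\<bar> \<le> 4 * C) \<longrightarrow>
        ennreal s * X g \<le> M + ennreal c * I g" if s: "0 < s" for s
      using action_bound[OF T J assms(4,5) j bd s, of "4 * C"] unfolding X_def M_def I_def .
    have grad_f: "AE z in edge_measure \<pi> \<kappa>. \<bar>nonlocal_grad f z\<bar> \<le> 2 * C"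
      using AE_edge_measure_fst[OF \<pi> C(2), of \<kappa>] AE_edge_measure_snd[OF \<pi> sw C(2)]
      by eventually_elim (simp add: nonlocal_grad_def case_prod_beta)
    \<comment> \<open>Each of the two gradients contributes at most \<open>2 * C\<close>, which
      explains the bound \<open>4 * C\<close>.\<close>
    have grad_G: "AE z in edge_measure \<pi> \<kappa>. \<bar>nonlocal_grad (G n) z - nonlocal_grad f z\<bar> \<le> 4 * C" for n
      using grad_f
    proof eventually_elim
      fix z assume "\<bar>nonlocal_grad f z\<bar> \<le> 2 * C"
      then show "\<bar>nonlocal_grad (G n) z - nonlocal_grad f z\<bar> \<le> 4 * C"
        using G(2)[of n "fst z"] G(2)[of n "snd z"] unfolding nonlocal_grad_def case_prod_beta by linarith
    qed
    show ?thesis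
    proof (rule tested_continuity_equation_limit[OF j f_meas _ _ _ CE[OF G(1)]])
      fix t assume t: "t \<in> {0..T}"
      interpret \<rho>t: finite_measure "\<rho> t" by (rule \<rho>(2)[OF t])
      note [measurable_cong] = \<rho>(1)[OF t]
      \<comment> \<open>Absolute continuity transfers the essential bound of \<open>f\<close> and
        the pointwise limit from \<open>\<pi>\<close> to \<open>\<rho> t\<close>; the constant
        \<open>C\<close> dominates on this finite measure.\<close>
      have \<rho>AE: "AE x in \<rho> t. P x" if "AE x in \<pi>. P x" for P
        using absolutely_continuous_AE[OF _ ac[OF t] that] \<rho>(1)[OF t] \<pi> by simp
      show "integrable (\<rho> t) f"
        using \<rho>AE[OF C(2)] by (intro \<rho>t.integrable_const_bound[where B = C]) auto
      show "(\<lambda>n. LINT x|\<rho> t. G n x) \<longlonglongrightarrow> (LINT x|\<rho> t. f x)"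
        using \<rho>AE[OF pt] G(2)
        by (intro integral_dominated_convergence[where w = "\<lambda>_. C"]) auto
    next
      have "AE z in edge_measure \<pi> \<kappa>. \<bar>nonlocal_grad f z\<bar> \<le> 4 * C"
        using grad_f by eventually_elim (use C(1) in simp)
      moreover have "nonlocal_grad f \<in> borel_measurable borel" by measurable
      \<comment> \<open>The value \<open>s = 1\<close> suffices here, since only finiteness is
        wanted.\<close>
      ultimately obtain c where "ennreal 1 * X (nonlocal_grad f) \<le> M + ennreal c * I (nonlocal_grad f)"
        using bound[OF zero_less_one] by blast
      moreover have "I (nonlocal_grad f) < \<infinity>"
        using f by (simp add: I_def X2_def nn_integral_nonlocal_grad_off_diagonal)
      ultimately have "X (nonlocal_grad f) < \<infinity>"
        using M by (auto simp: ennreal_mult_less_top elim: le_less_trans)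
      then show "(\<integral>\<^sup>+t\<in>{0..T}. (\<integral>\<^sup>+z. ennreal \<bar>nonlocal_grad f z\<bar> \<partial>total_variation (j t)) \<partial>lborel) < \<infinity>"
        by (simp add: X_def)
    next
      have "(\<lambda>n. X (\<lambda>z. nonlocal_grad (G n) z - nonlocal_grad f z)) \<longlonglongrightarrow> 0"
      proof (rule tendsto_0_ennreal_scaling[OF M L2])
        fix s :: real assume "0 < s"
        from bound[OF this] obtain c where c: "\<And>g. g \<in> borel_measurable borel \<Longrightarrow>
            AE z in edge_measure \<pi> \<kappa>. \<bar>g z\<bar> \<le> 4 * C \<Longrightarrow> ennreal s * X g \<le> M + ennreal c * I g" by blast
        show "\<exists>c. \<forall>n. ennreal s * X (\<lambda>z. nonlocal_grad (G n) z - nonlocal_grad f z)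
            \<le> M + ennreal c * (\<integral>\<^sup>+z. ennreal ((nonlocal_grad (G n) z - nonlocal_grad f z)\<^sup>2) \<partial>edge_measure \<pi> \<kappa>)"
          unfolding I_def[symmetric] by (intro exI[of _ c] allI c grad_G) measurable
      qed
      then show "(\<lambda>n. \<integral>\<^sup>+t\<in>{0..T}. (\<integral>\<^sup>+z. ennreal \<bar>nonlocal_grad (G n) z - nonlocal_grad f z\<bar>
          \<partial>total_variation (j t)) \<partial>lborel) \<longlonglongrightarrow> 0"
        by (simp add: X_def)
    qed measurable
  qed
  with assms(8) bd show ?thesis by (simp add: RCE_def)
qed

end
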